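(* Let $E,A\in\mathbb{R}^{n\times n}$ with $\operatorname{rank}(E)=r$. Then $(E,A)$ is regular, of index at most one, and asymptotically stable if and only if there exist invertible $T,W\in\mathbb{R}^{n\times n}$ and $S,U,B\in\mathbb{R}^{r\times r}$ with $S$ invertible, $U^TU=I_r$, $B$ symmetric positive semidefinite and $\|B\|<1$, such that $$E=W\begin{bmatrix} I_r&0\\0&0\end{bmatrix}T,\qquad A=W\begin{bmatrix} S^{-1}UBS&0\\0&I_{n-r}\end{bmatrix}T.$$
   Context: A pair $(E,A)$ of real $n\times n$ matrices is regular if $\det(\lambda E-A)$ is not identically zero in $\lambda$; its finite eigenvalues are the roots of $\det(zE-A)$. The index of a regular pair is defined via the Weierstrass canonical form $E=W\operatorname{diag}(I_q,N)T$, $A=W\operatorname{diag}(J,I_{n-q})T$ ($N$ nilpotent) as the nilpotency degree of $N$ if $q<n$, and $0$ if $E$ is nonsingular. The pair is asymptotically stable if all its finite eigenvalues lie in the open unit disk $\{|z|<1\}$. $\|\cdot\|$ is the spectral norm. *)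

theory Defs
  imports Complex_Main "Jordan_Normal_Form.Matrix" "Jordan_Normal_Form.DL_Rank"
begin

definition regular_pair :: "real mat \<Rightarrow> real mat \<Rightarrow> bool" where
  "regular_pair E A \<longleftrightarrow> (\<exists>t::real. det (t \<cdot>\<^sub>m E - A) \<noteq> 0)"

definition finite_eigenvalues :: "real mat \<Rightarrow> real mat \<Rightarrow> complex set" where
  "finite_eigenvalues E A =
     {z. det (z \<cdot>\<^sub>m map_mat complex_of_real E - map_mat complex_of_real A) = 0}"

definition asymp_stable :: "real mat \<Rightarrow> real mat \<Rightarrow> bool" where
  "asymp_stable E A \<longleftrightarrow> (\<forall>z \<in> finite_eigenvalues E A. cmod z < 1)"

definition nilp_degree :: "real mat \<Rightarrow> nat" where
  "nilp_degree N = (LEAST k. N ^\<^sub>m k = 0\<^sub>m (dim_row N) (dim_row N))"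

definition weierstrass_form ::
  "nat \<Rightarrow> real mat \<Rightarrow> real mat \<Rightarrow> nat \<Rightarrow> real mat \<Rightarrow> real mat \<Rightarrow> real mat \<Rightarrow> real mat \<Rightarrow> bool" where
  "weierstrass_form n E A q W T J N \<longleftrightarrow>
     q \<le> n \<and>
     W \<in> carrier_mat n n \<and> T \<in> carrier_mat n n \<and> invertible_mat W \<and> invertible_mat T \<and>
     J \<in> carrier_mat q q \<and> N \<in> carrier_mat (n - q) (n - q) \<and>
     (\<exists>k. N ^\<^sub>m k = 0\<^sub>m (n - q) (n - q)) \<and>
     E = W * four_block_mat (1\<^sub>m q) (0\<^sub>m q (n - q)) (0\<^sub>m (n - q) q) N * T \<and>
     A = W * four_block_mat J (0\<^sub>m q (n - q)) (0\<^sub>m (n - q) q) (1\<^sub>m (n - q)) * T"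

definition wcf_index :: "nat \<Rightarrow> nat \<Rightarrow> real mat \<Rightarrow> nat" where
  "wcf_index n q N = (if q < n then nilp_degree N else 0)"

text \<open>The (well-defined) index of a regular pair is at most k.\<close>
definition index_at_most :: "nat \<Rightarrow> real mat \<Rightarrow> real mat \<Rightarrow> nat \<Rightarrow> bool" where
  "index_at_most n E A k \<longleftrightarrow>
     (\<exists>q W T J N. weierstrass_form n E A q W T J N \<and> wcf_index n q N \<le> k)"

definition vnorm :: "real vec \<Rightarrow> real" where
  "vnorm x = sqrt (x \<bullet> x)"

definition spec_norm :: "real mat \<Rightarrow> real" where
  "spec_norm B = Sup ({0} \<union> {vnorm (B *\<^sub>v x) | x. x \<in> carrier_vec (dim_col B) \<and> vnorm x = 1})"

definition psd_mat :: "real mat \<Rightarrow> bool" where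
  "psd_mat B \<longleftrightarrow> (\<forall>x \<in> carrier_vec (dim_row B). 0 \<le> x \<bullet> (B *\<^sub>v x))"

end

theory Submission
  imports Defs "Jordan_Normal_Form.Spectral_Radius"
begin

text \<open>In Weierstrass form, index at most one means \<open>N = 0\<close>, so that \<open>q = rank E\<close> and the finite
  eigenvalues of the pair are the eigenvalues of \<open>J\<close>. It remains to see that a real matrix \<open>J\<close> has
  spectral radius below one iff it is similar to a matrix \<open>U B\<close> with \<open>U\<close> orthogonal, \<open>B\<close> positive
  semidefinite and \<open>\<parallel>B\<parallel> < 1\<close>. If \<open>J\<^sup>k\<^sup>+\<^sup>1\<close> is a contraction, then the Lyapunov function
  \<open>x \<mapsto> \<Sum>j\<le>k. \<parallel>J\<^sup>j x\<parallel>\<^sup>2\<close> has the form \<open>\<parallel>S x\<parallel>\<^sup>2\<close> with \<open>S\<close> invertible and decreases strictly under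
  \<open>J\<close>; thus \<open>S J S\<^sup>-\<^sup>1\<close> is a strict contraction, whose polar decomposition is \<open>U B\<close>. Both the factor
  \<open>S\<close> and the polar decomposition come from the singular value decomposition, which is
  proved by splitting off one singular pair at a time.\<close>

section \<open>Orthogonal matrices and the real scalar product\<close>

definition orth_mat :: "nat \<Rightarrow> real mat \<Rightarrow> bool" where
  "orth_mat n Q \<longleftrightarrow> Q \<in> carrier_mat n n \<and> Q\<^sup>T * Q = 1\<^sub>m n"

lemma orth_matD:
  assumes "orth_mat n Q"
  shows "Q \<in> carrier_mat n n" "Q\<^sup>T * Q = 1\<^sub>m n" "Q * Q\<^sup>T = 1\<^sub>m n"
  using assms mat_mult_left_right_inverse[of "Q\<^sup>T" n Q] unfolding orth_mat_def by auto

lemma orth_mat_transpose: "orth_mat n Q \<Longrightarrow> orth_mat n Q\<^sup>T"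
  using orth_matD[of n Q] unfolding orth_mat_def by auto

lemma orth_mat_mult:
  assumes P: "orth_mat n P" and Q: "orth_mat n Q"
  shows "orth_mat n (P * Q)"
proof -
  note [simp] = orth_matD[OF P] orth_matD[OF Q]
    assoc_mult_mat[of _ n n _ n _ n] mult_carrier_mat[of _ n n _ n]
  have "(P * Q)\<^sup>T * (P * Q) = Q\<^sup>T * (P\<^sup>T * (P * Q))"
    by (simp add: transpose_mult[of _ n n _ n])
  also have "P\<^sup>T * (P * Q) = (P\<^sup>T * P) * Q"
    by (rule assoc_mult_mat[symmetric, of _ n n _ n _ n]) auto
  finally show ?thesis unfolding orth_mat_def by (simp add: left_mult_one_mat[of Q n n])
qed

lemma scalar_prod_mult_mat_vec:
  fixes A :: "real mat"
  assumes "A \<in> carrier_mat nr nc" "x \<in> carrier_vec nc" "y \<in> carrier_vec nr"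
  shows "(A *\<^sub>v x) \<bullet> y = x \<bullet> (A\<^sup>T *\<^sub>v y)"
  using transpose_vec_mult_scalar[of "A\<^sup>T" nc nr y x] assms by simp

lemma orth_mat_isometry:
  assumes Q: "orth_mat n Q" and x: "x \<in> carrier_vec n"
  shows "(Q *\<^sub>v x) \<bullet> (Q *\<^sub>v x) = x \<bullet> x"
proof -
  have "(Q *\<^sub>v x) \<bullet> (Q *\<^sub>v x) = x \<bullet> ((Q\<^sup>T * Q) *\<^sub>v x)"
    using orth_matD(1)[OF Q] x by (subst scalar_prod_mult_mat_vec[of _ n n]) auto
  then show ?thesis using orth_matD[OF Q] x by simp
qed

lemma scalar_prod_self_nonneg: "0 \<le> (x :: real vec) \<bullet> x"
  unfolding scalar_prod_def by (intro sum_nonneg) auto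

lemma scalar_prod_self_eq_0:
  "(x :: real vec) \<in> carrier_vec n \<Longrightarrow> x \<bullet> x = 0 \<longleftrightarrow> x = 0\<^sub>v n"
  by (auto simp: scalar_prod_def sum_nonneg_eq_0_iff)

lemma scalar_prod_self_pos:
  "(x :: real vec) \<in> carrier_vec n \<Longrightarrow> x \<noteq> 0\<^sub>v n \<Longrightarrow> 0 < x \<bullet> x"
  using scalar_prod_self_nonneg[of x] scalar_prod_self_eq_0[of x n] by linarith

lemma normalize_vec:
  fixes x :: "real vec"
  assumes "x \<in> carrier_vec n" "x \<noteq> 0\<^sub>v n"
  shows "(inverse (sqrt (x \<bullet> x)) \<cdot>\<^sub>v x) \<bullet> (inverse (sqrt (x \<bullet> x)) \<cdot>\<^sub>v x) = 1"
  using scalar_prod_self_pos[OF assms] assms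
  by (simp add: field_simps)

lemma mult_mat_unit_vec:
  "(A :: 'a :: semiring_1 mat) \<in> carrier_mat nr nc \<Longrightarrow> i < nc \<Longrightarrow> A *\<^sub>v unit_vec nc i = col A i"
  by (intro eq_vecI) auto

text \<open>The columns are the images of the unit vectors. This allows an identity such as
  \<open>H * H = 1\<^sub>m n\<close> to be checked on vectors, where a reflection has a simple
  formula.\<close>

lemma eq_mat_by_mult_vec:
  fixes A B :: "'a :: semiring_1 mat"
  assumes A: "A \<in> carrier_mat nr nc" and B: "B \<in> carrier_mat nr nc"
    and eq: "\<And>x. x \<in> carrier_vec nc \<Longrightarrow> A *\<^sub>v x = B *\<^sub>v x"
  shows "A = B"
proof (rule mat_col_eqI)
  fix i assume "i < dim_col B"
  then show "col A i = col B i"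
    using eq[of "unit_vec nc i"] A B by (simp add: mult_mat_unit_vec)
qed (use A B in auto)

text \<open>The Householder reflection exchanging the first unit vector with $v$.\<close>

lemma orth_mat_first_col:
  fixes v :: "real vec"
  assumes v: "v \<in> carrier_vec n" and v1: "v \<bullet> v = 1" and n: "0 < n"
  shows "\<exists>H. orth_mat n H \<and> H *\<^sub>v unit_vec n 0 = v"
proof (cases "v = unit_vec n 0")
  case True
  then show ?thesis using v by (intro exI[of _ "1\<^sub>m n"]) (auto simp: orth_mat_def)
next
  case False
  define e :: "real vec" where "e = unit_vec n 0"
  define w where "w = e - v"
  \<comment> \<open>With this scaling, \<open>H\<close> below is the reflection in the hyperplane
    orthogonal to \<open>w\<close>; the case distinction keeps \<open>w\<close> nonzero.\<close>
  define c where "c = 2 / (w \<bullet> w)"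
  define H where "H = mat n n (\<lambda>(i, j). (if i = j then 1 else 0) - c * w $ i * w $ j)"
  have e: "e \<in> carrier_vec n" "e \<bullet> e = 1" unfolding e_def using n by auto
  have w: "w \<in> carrier_vec n" unfolding w_def using e v by auto
  have "w \<noteq> 0\<^sub>v n"
  proof
    assume 0: "w = 0\<^sub>v n"
    have "v = e"
    proof (rule eq_vecI)
      fix i assume "i < dim_vec e"
      then have "i < n" using e by simp
      then show "v $ i = e $ i" using arg_cong[OF 0, of "\<lambda>u. u $ i"] e v unfolding w_def by simp
    qed (use e v in simp)
    then show False using False unfolding e_def by simp
  qed
  then have cw: "c * (w \<bullet> w) = 2" using scalar_prod_self_pos[OF w] unfolding c_def by simp
  have H: "H \<in> carrier_mat n n" unfolding H_def by simp
  have HT: "H\<^sup>T = H" unfolding H_def by (rule eq_matI) auto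
  have Hx: "H *\<^sub>v x = x - (c * (w \<bullet> x)) \<cdot>\<^sub>v w" if x: "x \<in> carrier_vec n" for x
  proof (rule eq_vecI)
    fix i assume "i < dim_vec (x - (c * (w \<bullet> x)) \<cdot>\<^sub>v w)"
    then have i: "i < n" using w by auto
    have "(H *\<^sub>v x) $ i = (\<Sum>j = 0..<n. ((if i = j then 1 else 0) - c * w $ i * w $ j) * x $ j)"
      using i x unfolding H_def by (simp add: scalar_prod_def)
    also have "\<dots> = (\<Sum>j = 0..<n. (if i = j then x $ j else 0)) - c * w $ i * (\<Sum>j = 0..<n. w $ j * x $ j)"
      unfolding sum_distrib_left sum_subtractf[symmetric] by (rule sum.cong) (auto simp: algebra_simps)
    also have "\<dots> = x $ i - c * w $ i * (w \<bullet> x)"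
      using i x by (simp add: scalar_prod_def)
    finally show "(H *\<^sub>v x) $ i = (x - (c * (w \<bullet> x)) \<cdot>\<^sub>v w) $ i" using i x w by simp
  qed (use x w in \<open>auto simp: H_def\<close>)
  have "H * H = 1\<^sub>m n"
  proof (rule eq_mat_by_mult_vec)
    fix x :: "real vec" assume x: "x \<in> carrier_vec n"
    let ?y = "x - (c * (w \<bullet> x)) \<cdot>\<^sub>v w"
    have y: "?y \<in> carrier_vec n" using x w by auto
    have "w \<bullet> ?y = w \<bullet> x - (c * (w \<bullet> w)) * (w \<bullet> x)"
      using x w by (simp add: scalar_prod_minus_distrib[of _ n])
    then have wy: "w \<bullet> ?y = - (w \<bullet> x)" unfolding cw by simp
    have "(H * H) *\<^sub>v x = H *\<^sub>v ?y" using H x Hx[OF x] by simp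
    also have "\<dots> = ?y - (c * (w \<bullet> ?y)) \<cdot>\<^sub>v w" by (rule Hx[OF y])
    also have "\<dots> = 1\<^sub>m n *\<^sub>v x" unfolding wy using x w by (intro eq_vecI) auto
    finally show "(H * H) *\<^sub>v x = 1\<^sub>m n *\<^sub>v x" .
  qed (use H in auto)
  then have "orth_mat n H" using H HT unfolding orth_mat_def by simp
  moreover have "H *\<^sub>v e = v"
  proof -
    \<comment> \<open>As \<open>e\<close> and \<open>v\<close> both have length one, both sides
      equal 2 - 2 (\<open>e \<bullet> v\<close>). Hence the reflection subtracts exactly
      \<open>w\<close> from \<open>e\<close>.\<close>
    have ww: "w \<bullet> w = 2 * (w \<bullet> e)"
      unfolding w_def using e v v1 comm_scalar_prod[OF e(1) v]
      by (simp add: scalar_prod_minus_distrib[of _ n] minus_scalar_prod_distrib[of _ n])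
    have "c * (w \<bullet> e) = 1" using cw unfolding ww by simp
    then have "H *\<^sub>v e = e - w" using Hx[OF e(1)] by simp
    also have "\<dots> = v" unfolding w_def using e v by (intro eq_vecI) auto
    finally show ?thesis .
  qed
  ultimately show ?thesis unfolding e_def by blast
qed

section \<open>Real eigenvectors of symmetric matrices\<close>

text \<open>Real and imaginary parts of M x = z x with x = a + i b. The real plane spanned by
  \<open>a\<close> and \<open>b\<close> replaces the complex eigenvector, so that all later norm
  computations stay over the reals.\<close>

lemma complex_eigenvalue_real_parts:
  assumes M: "M \<in> carrier_mat n n" and ev: "eigenvalue (map_mat complex_of_real M) z"
  obtains a b where "a \<in> carrier_vec n" "b \<in> carrier_vec n" "a \<noteq> 0\<^sub>v n \<or> b \<noteq> 0\<^sub>v n"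
    "M *\<^sub>v a = Re z \<cdot>\<^sub>v a - Im z \<cdot>\<^sub>v b" "M *\<^sub>v b = Im z \<cdot>\<^sub>v a + Re z \<cdot>\<^sub>v b"
proof -
  from ev obtain x where x: "x \<in> carrier_vec n" "x \<noteq> 0\<^sub>v n"
    and eq: "map_mat complex_of_real M *\<^sub>v x = z \<cdot>\<^sub>v x"
    using M unfolding eigenvalue_def eigenvector_def by auto
  define a where "a = map_vec Re x"
  define b where "b = map_vec Im x"
  have ab: "a \<in> carrier_vec n" "b \<in> carrier_vec n" using x unfolding a_def b_def by auto
  have "a \<noteq> 0\<^sub>v n \<or> b \<noteq> 0\<^sub>v n"
  proof (rule ccontr)
    assume "\<not> ?thesis"
    then have "a = 0\<^sub>v n" "b = 0\<^sub>v n" by auto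
    then have "Re (x $ i) = 0" "Im (x $ i) = 0" if "i < n" for i
      using that x unfolding a_def b_def by (metis index_map_vec(1) index_zero_vec(1) carrier_vecD)+
    then have "x = 0\<^sub>v n" using x(1) by (intro eq_vecI) (auto simp: complex_eq_iff)
    then show False using x by simp
  qed
  moreover have comp: "(\<Sum>j = 0..<n. complex_of_real (M $$ (i, j)) * x $ j) = z * x $ i" if i: "i < n" for i
    using arg_cong[OF eq, of "\<lambda>v. v $ i"] i M x by (simp add: scalar_prod_def)
  have "M *\<^sub>v a = Re z \<cdot>\<^sub>v a - Im z \<cdot>\<^sub>v b"
  proof (rule eq_vecI)
    fix i assume "i < dim_vec (Re z \<cdot>\<^sub>v a - Im z \<cdot>\<^sub>v b)"
    then have i: "i < n" using ab by auto
    show "(M *\<^sub>v a) $ i = (Re z \<cdot>\<^sub>v a - Im z \<cdot>\<^sub>v b) $ i"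
      using arg_cong[OF comp[OF i], of Re] i M x unfolding a_def b_def by (simp add: scalar_prod_def)
  qed (use M ab in auto)
  moreover have "M *\<^sub>v b = Im z \<cdot>\<^sub>v a + Re z \<cdot>\<^sub>v b"
  proof (rule eq_vecI)
    fix i assume "i < dim_vec (Im z \<cdot>\<^sub>v a + Re z \<cdot>\<^sub>v b)"
    then have i: "i < n" using ab by auto
    show "(M *\<^sub>v b) $ i = (Im z \<cdot>\<^sub>v a + Re z \<cdot>\<^sub>v b) $ i"
      using arg_cong[OF comp[OF i], of Im] i M x unfolding a_def b_def
      by (simp add: scalar_prod_def algebra_simps)
  qed (use M ab in auto)
  ultimately show ?thesis using that ab by blast
qed

text \<open>Some complex eigenvalue exists because \<open>n\<close> is positive, and symmetry forces
  its imaginary part to vanish. Then whichever of \<open>a\<close> and \<open>b\<close> is nonzero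
  is a real eigenvector.\<close>

lemma symmetric_real_eigenvector:
  fixes M :: "real mat"
  assumes M: "M \<in> carrier_mat n n" and sym: "M\<^sup>T = M" and n: "0 < n"
  shows "\<exists>c v. v \<in> carrier_vec n \<and> v \<bullet> v = 1 \<and> M *\<^sub>v v = c \<cdot>\<^sub>v v"
proof -
  have "spectrum (map_mat complex_of_real M) \<noteq> {}"
    using spectrum_non_empty[of "map_mat complex_of_real M" n] M n by auto
  then obtain z where "eigenvalue (map_mat complex_of_real M) z" unfolding spectrum_def by auto
  from complex_eigenvalue_real_parts[OF M this] obtain a b
    where a: "a \<in> carrier_vec n" and b: "b \<in> carrier_vec n" and ab: "a \<noteq> 0\<^sub>v n \<or> b \<noteq> 0\<^sub>v n"
      and Ma: "M *\<^sub>v a = Re z \<cdot>\<^sub>v a - Im z \<cdot>\<^sub>v b" and Mb: "M *\<^sub>v b = Im z \<cdot>\<^sub>v a + Re z \<cdot>\<^sub>v b" .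
  have "(M *\<^sub>v a) \<bullet> b = a \<bullet> (M *\<^sub>v b)"
    using scalar_prod_mult_mat_vec[OF M a b] sym by simp
  \<comment> \<open>The terms with \<open>Re z\<close> on the two sides are equal and
    cancel.\<close>
  then have "Im z * (a \<bullet> a + b \<bullet> b) = 0"
    unfolding Ma Mb using a b
    by (simp add: scalar_prod_add_distrib[of _ n] minus_scalar_prod_distrib[of _ n] algebra_simps)
  moreover have "a \<bullet> a + b \<bullet> b > 0"
    using ab scalar_prod_self_pos[OF a] scalar_prod_self_pos[OF b]
      scalar_prod_self_nonneg[of a] scalar_prod_self_nonneg[of b] by linarith
  ultimately have "Im z = 0" by simp
  then have "M *\<^sub>v a = Re z \<cdot>\<^sub>v a" "M *\<^sub>v b = Re z \<cdot>\<^sub>v b"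
    unfolding Ma Mb using a b by auto
  with ab a b obtain x where x: "x \<in> carrier_vec n" "x \<noteq> 0\<^sub>v n" and Mx: "M *\<^sub>v x = Re z \<cdot>\<^sub>v x"
    by blast
  let ?k = "inverse (sqrt (x \<bullet> x))"
  have "M *\<^sub>v (?k \<cdot>\<^sub>v x) = Re z \<cdot>\<^sub>v (?k \<cdot>\<^sub>v x)"
    using mult_mat_vec[OF M x(1)] Mx by (simp add: smult_smult_assoc mult.commute)
  then show ?thesis using normalize_vec[OF x] x(1) by (intro exI conjI) auto
qed

section \<open>Singular value decomposition\<close>

text \<open>Take for \<open>v\<close> a unit eigenvector of \<open>K\<^sup>T * K\<close> and for
  \<open>u\<close> the normalized image \<open>K *\<^sub>v v\<close>. If that image is zero, then
  \<open>s\<close> is 0 and \<open>u\<close> has to come from the kernel of \<open>K\<^sup>T\<close>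
  instead.\<close>

lemma singular_pair:
  fixes K :: "real mat"
  assumes K: "K \<in> carrier_mat n n" and n: "0 < n"
  shows "\<exists>u v s. u \<in> carrier_vec n \<and> v \<in> carrier_vec n \<and> u \<bullet> u = 1 \<and> v \<bullet> v = 1 \<and> 0 \<le> s \<and>
    K *\<^sub>v v = s \<cdot>\<^sub>v u \<and> K\<^sup>T *\<^sub>v u = s \<cdot>\<^sub>v v"
proof -
  have "(K\<^sup>T * K)\<^sup>T = K\<^sup>T * K" using K by (simp add: transpose_mult[of _ n n _ n])
  from symmetric_real_eigenvector[OF _ this n] K obtain c v
    where v: "v \<in> carrier_vec n" "v \<bullet> v = 1" and ev: "(K\<^sup>T * K) *\<^sub>v v = c \<cdot>\<^sub>v v" by auto
  have Kv: "K *\<^sub>v v \<in> carrier_vec n" using K v by simp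
  have ev': "K\<^sup>T *\<^sub>v (K *\<^sub>v v) = c \<cdot>\<^sub>v v"
    using ev assoc_mult_mat_vec[of "K\<^sup>T" n n K n v] K v by simp
  \<comment> \<open>The eigenvalue is a squared length, hence has a real square root, the singular
    value.\<close>
  have c: "c = (K *\<^sub>v v) \<bullet> (K *\<^sub>v v)"
    using scalar_prod_mult_mat_vec[OF K v(1) Kv] ev' v by simp
  show ?thesis
  proof (cases "K *\<^sub>v v = 0\<^sub>v n")
    case True
    have "v \<noteq> 0\<^sub>v n" using v by auto
    \<comment> \<open>For a square matrix the determinant carries the nontrivial kernel over from
      \<open>K\<close> to its transpose.\<close>
    then have "det K = 0" using True v det_0_iff_vec_prod_zero[OF K] by blast
    then have "det K\<^sup>T = 0" using det_transpose[OF K] by simp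
    then obtain x where x: "x \<in> carrier_vec n" "x \<noteq> 0\<^sub>v n" "K\<^sup>T *\<^sub>v x = 0\<^sub>v n"
      using det_0_iff_vec_prod_zero[of "K\<^sup>T" n] K by auto
    define u where "u = inverse (sqrt (x \<bullet> x)) \<cdot>\<^sub>v x"
    have u: "u \<in> carrier_vec n" "u \<bullet> u = 1" unfolding u_def using x normalize_vec[OF x(1,2)] by auto
    have "K\<^sup>T *\<^sub>v u = 0\<^sub>v n" unfolding u_def using mult_mat_vec[of "K\<^sup>T" n n x] K x by auto
    then have "K *\<^sub>v v = 0 \<cdot>\<^sub>v u" "K\<^sup>T *\<^sub>v u = 0 \<cdot>\<^sub>v v" using True u v by auto
    then show ?thesis using u v by (intro exI conjI) auto
  next
    case False
    define s where "s = sqrt c"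
    have cpos: "c > 0" using scalar_prod_self_pos[OF Kv False] c by simp
    then have s: "0 < s" "s * s = c" unfolding s_def by auto
    define u where "u = inverse s \<cdot>\<^sub>v (K *\<^sub>v v)"
    have u: "u \<in> carrier_vec n" "u \<bullet> u = 1"
      unfolding u_def s_def c using Kv normalize_vec[OF Kv False] by auto
    have "K *\<^sub>v v = s \<cdot>\<^sub>v u" unfolding u_def using s Kv by (simp add: smult_smult_assoc)
    moreover have "K\<^sup>T *\<^sub>v u = s \<cdot>\<^sub>v v"
    proof -
      have "inverse s * c = s" using s by (metis left_inverse mult.assoc mult_1 less_irrefl)
      then show ?thesis
        unfolding u_def using mult_mat_vec[of "K\<^sup>T" n n "K *\<^sub>v v"] K Kv ev'
        by (simp add: smult_smult_assoc)
    qed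
    ultimately show ?thesis using u v s by (intro exI[of _ u] exI[of _ v] exI[of _ s]) auto
  qed
qed

lemma orth_mat_four_block:
  assumes Q: "orth_mat n Q"
  shows "orth_mat (1 + n) (four_block_mat (1\<^sub>m 1) (0\<^sub>m 1 n) (0\<^sub>m n 1) Q)"
proof -
  note [simp] = orth_matD[OF Q] left_mult_zero_mat[of _ n n] right_mult_zero_mat[of _ n n]
  have "(four_block_mat (1\<^sub>m 1) (0\<^sub>m 1 n) (0\<^sub>m n 1) Q)\<^sup>T * four_block_mat (1\<^sub>m 1) (0\<^sub>m 1 n) (0\<^sub>m n 1) Q
    = four_block_mat (1\<^sub>m 1) (0\<^sub>m 1 n) (0\<^sub>m n 1) (1\<^sub>m n)"
    by (subst transpose_four_block_mat[of _ 1 1 _ n _ n], simp_all,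
        subst mult_four_block_mat[of _ 1 1 _ n _ n _ _ 1 _ n], simp_all)
  then show ?thesis
    unfolding orth_mat_def using four_block_carrier_mat[of "1\<^sub>m 1" 1 1 Q n n] by simp
qed

lemma mat_diag_four_block:
  "mat_diag (Suc n) (\<lambda>i. case i of 0 \<Rightarrow> s | Suc j \<Rightarrow> d j) =
    four_block_mat (mat 1 1 (\<lambda>_. s)) (0\<^sub>m 1 n) (0\<^sub>m n 1) (mat_diag n d)"
  by (rule eq_matI) (auto simp: mat_diag_def split: nat.splits)

text \<open>Induction on the dimension: orthogonal \<open>G\<close> and \<open>H\<close> with first
  columns \<open>u\<close> and \<open>v\<close> from a singular pair turn \<open>K\<close> into a
  block diagonal matrix with corner \<open>s\<close>, and the remaining block is decomposed by the
  induction hypothesis. The singular values form a function on all naturals, so that a new one can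
  be put in front by a shift.\<close>

theorem singular_value_decomposition:
  fixes K :: "real mat"
  assumes "K \<in> carrier_mat n n"
  shows "\<exists>V d Q. orth_mat n V \<and> orth_mat n Q \<and> (\<forall>i. 0 \<le> d i) \<and> K = V * mat_diag n d * Q\<^sup>T"
  using assms
proof (induction n arbitrary: K)
  case 0
  then show ?case by (intro exI[of _ "1\<^sub>m 0"] exI[of _ "\<lambda>_. 0"]) (auto simp: orth_mat_def)
next
  case (Suc n)
  let ?m = "Suc n"
  let ?e = "unit_vec ?m 0 :: real vec"
  note K = Suc.prems
  from singular_pair[OF K] obtain u v s
    where u: "u \<in> carrier_vec ?m" "u \<bullet> u = 1" and v: "v \<in> carrier_vec ?m" "v \<bullet> v = 1" and s: "0 \<le> s"
      and Kv: "K *\<^sub>v v = s \<cdot>\<^sub>v u" and Ku: "K\<^sup>T *\<^sub>v u = s \<cdot>\<^sub>v v" by auto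
  from orth_mat_first_col[OF u] obtain G where G: "orth_mat ?m G" and Ge: "G *\<^sub>v ?e = u" by auto
  from orth_mat_first_col[OF v] obtain H where H: "orth_mat ?m H" and He: "H *\<^sub>v ?e = v" by auto
  note G' = orth_matD[OF G] and H' = orth_matD[OF H]
  define M where "M = G\<^sup>T * K * H"
  have M: "M \<in> carrier_mat ?m ?m" unfolding M_def using G' H' K by auto
  have "G\<^sup>T *\<^sub>v u = (G\<^sup>T * G) *\<^sub>v ?e"
    using G'(1) by (simp add: assoc_mult_mat_vec[of _ ?m ?m _ ?m] Ge)
  then have Gu: "G\<^sup>T *\<^sub>v u = ?e" using G'(2) by simp
  have "H\<^sup>T *\<^sub>v v = (H\<^sup>T * H) *\<^sub>v ?e"
    using H'(1) by (simp add: assoc_mult_mat_vec[of _ ?m ?m _ ?m] He)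
  then have Hv: "H\<^sup>T *\<^sub>v v = ?e" using H'(2) by simp
  have "M *\<^sub>v ?e = G\<^sup>T *\<^sub>v (K *\<^sub>v v)"
    unfolding M_def using G'(1) H'(1) K by (simp add: assoc_mult_mat_vec[of _ ?m ?m _ ?m] He)
  also have "\<dots> = s \<cdot>\<^sub>v ?e" unfolding Kv using mult_mat_vec[of "G\<^sup>T" ?m ?m u] G'(1) u Gu by simp
  finally have colM: "col M 0 = s \<cdot>\<^sub>v ?e" using mult_mat_unit_vec[OF M] by simp
  have "M\<^sup>T = H\<^sup>T * (K\<^sup>T * G)"
    unfolding M_def using G'(1) H'(1) K by (simp add: transpose_mult[of _ ?m ?m _ ?m])
  then have "M\<^sup>T *\<^sub>v ?e = H\<^sup>T *\<^sub>v (K\<^sup>T *\<^sub>v u)"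
    using G'(1) H'(1) K by (simp add: assoc_mult_mat_vec[of _ ?m ?m _ ?m] Ge)
  also have "\<dots> = s \<cdot>\<^sub>v ?e" unfolding Ku using mult_mat_vec[of "H\<^sup>T" ?m ?m v] H'(1) v Hv by simp
  finally have rowM: "row M 0 = s \<cdot>\<^sub>v ?e" using mult_mat_unit_vec[of "M\<^sup>T" ?m ?m 0] M by simp
  define L where "L = mat n n (\<lambda>(i, j). M $$ (Suc i, Suc j))"
  have L: "L \<in> carrier_mat n n" unfolding L_def by simp
  \<comment> \<open>The equation for \<open>K *\<^sub>v v\<close> clears the first column and the
    one for \<open>K\<^sup>T *\<^sub>v u\<close> the first row.\<close>
  have Mblock: "M = four_block_mat (mat 1 1 (\<lambda>_. s)) (0\<^sub>m 1 n) (0\<^sub>m n 1) L"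
  proof (rule eq_matI)
    fix i j
    assume "i < dim_row (four_block_mat (mat 1 1 (\<lambda>_. s)) (0\<^sub>m 1 n) (0\<^sub>m n 1) L)"
      and "j < dim_col (four_block_mat (mat 1 1 (\<lambda>_. s)) (0\<^sub>m 1 n) (0\<^sub>m n 1) L)"
    then have ij: "i < ?m" "j < ?m" using L by auto
    have "M $$ (i, 0) = s * ?e $ i" "M $$ (0, j) = s * ?e $ j"
      using arg_cong[OF colM, of "\<lambda>x. x $ i"] arg_cong[OF rowM, of "\<lambda>x. x $ j"] ij M by auto
    then show "M $$ (i, j) = four_block_mat (mat 1 1 (\<lambda>_. s)) (0\<^sub>m 1 n) (0\<^sub>m n 1) L $$ (i, j)"
      using ij L by (cases i; cases j) (auto simp: L_def)
  qed (use M L in auto)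
  from Suc.IH[OF L] obtain V d Q where V: "orth_mat n V" and Q: "orth_mat n Q"
    and d: "\<forall>i. 0 \<le> d i" and Leq: "L = V * mat_diag n d * Q\<^sup>T" by auto
  define V1 where "V1 = four_block_mat (1\<^sub>m 1) (0\<^sub>m 1 n) (0\<^sub>m n 1) V"
  define Q1 where "Q1 = four_block_mat (1\<^sub>m 1) (0\<^sub>m 1 n) (0\<^sub>m n 1) Q"
  define d1 where "d1 = (\<lambda>i. case i of 0 \<Rightarrow> s | Suc j \<Rightarrow> d j)"
  have V1: "orth_mat ?m V1" and Q1: "orth_mat ?m Q1"
    unfolding V1_def Q1_def using orth_mat_four_block[OF V] orth_mat_four_block[OF Q] by auto
  have D1: "mat_diag ?m d1 = four_block_mat (mat 1 1 (\<lambda>_. s)) (0\<^sub>m 1 n) (0\<^sub>m n 1) (mat_diag n d)"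
    unfolding d1_def by (rule mat_diag_four_block)
  have "V1 * mat_diag ?m d1 = four_block_mat (mat 1 1 (\<lambda>_. s)) (0\<^sub>m 1 n) (0\<^sub>m n 1) (V * mat_diag n d)"
    unfolding V1_def D1 using orth_matD[OF V]
    by (subst mult_four_block_mat[of _ 1 1 _ n _ n _ _ 1 _ n])
      (auto simp: left_mult_zero_mat[of _ n n] right_mult_zero_mat[of _ n n])
  then have "V1 * mat_diag ?m d1 * Q1\<^sup>T = M"
    unfolding Mblock Leq Q1_def using orth_matD[OF V] orth_matD[OF Q]
    by (subst transpose_four_block_mat[of _ 1 1 _ n _ n], simp_all,
        subst mult_four_block_mat[of _ 1 1 _ n _ n _ _ 1 _ n])
      (auto simp: left_mult_zero_mat[of _ n n] right_mult_zero_mat[of _ n n] mult_carrier_mat[of _ n n _ n])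
  moreover have "K = G * M * H\<^sup>T"
  proof -
    have "G * M * H\<^sup>T = (G * G\<^sup>T) * K * (H * H\<^sup>T)"
      unfolding M_def using G'(1) H'(1) K by (simp add: assoc_mult_mat[of _ ?m ?m _ ?m _ ?m] mult_carrier_mat[of _ ?m ?m _ ?m])
    then show ?thesis using G' H' K by simp
  qed
  ultimately have "K = G * (V1 * mat_diag ?m d1 * Q1\<^sup>T) * H\<^sup>T" by simp
  \<comment> \<open>Regrouped so that the outer factors are products of orthogonal matrices.\<close>
  then have "K = (G * V1) * mat_diag ?m d1 * (H * Q1)\<^sup>T"
    using G'(1) H'(1) orth_matD(1)[OF V1] orth_matD(1)[OF Q1]
    by (simp add: transpose_mult[of _ ?m ?m _ ?m] assoc_mult_mat[of _ ?m ?m _ ?m _ ?m] mult_carrier_mat[of _ ?m ?m _ ?m])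
  moreover have "\<forall>i. 0 \<le> d1 i" unfolding d1_def using s d by (auto split: nat.splits)
  ultimately show ?case using orth_mat_mult[OF G V1] orth_mat_mult[OF H Q1]
    by (intro exI[of _ "G * V1"] exI[of _ d1] exI[of _ "H * Q1"]) simp
qed

section \<open>Singular values and the spectral norm\<close>

lemma mat_diag_mult_vec:
  fixes x :: "real vec"
  assumes "x \<in> carrier_vec n"
  shows "mat_diag n d *\<^sub>v x = vec n (\<lambda>i. d i * x $ i)"
proof (rule eq_vecI)
  fix i assume "i < dim_vec (vec n (\<lambda>i. d i * x $ i))"
  then have i: "i < n" by simp
  have "(mat_diag n d *\<^sub>v x) $ i = (\<Sum>j = 0..<n. (if i = j then d j else 0) * x $ j)"
    using i assms unfolding mat_diag_def by (simp add: scalar_prod_def)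
  also have "\<dots> = (\<Sum>j = 0..<n. if i = j then d j * x $ j else 0)"
    by (rule sum.cong) auto
  finally show "(mat_diag n d *\<^sub>v x) $ i = vec n (\<lambda>i. d i * x $ i) $ i" using i by simp
qed (simp add: mat_diag_def)

lemma scalar_prod_self_sum: "x \<in> carrier_vec n \<Longrightarrow> x \<bullet> x = (\<Sum>i = 0..<n. (x $ i :: real)\<^sup>2)"
  by (auto simp: scalar_prod_def power2_eq_square)

text \<open>\<open>V\<close> preserves lengths, so only the diagonal factor acting on the
  coordinates \<open>Q\<^sup>T *\<^sub>v x\<close> changes them.\<close>

lemma svd_norm:
  assumes V: "orth_mat n V" and Q: "orth_mat n Q" and K: "K = V * mat_diag n d * Q\<^sup>T"
    and x: "x \<in> carrier_vec n"
  shows "(K *\<^sub>v x) \<bullet> (K *\<^sub>v x) = (\<Sum>i = 0..<n. (d i)\<^sup>2 * ((Q\<^sup>T *\<^sub>v x) $ i)\<^sup>2)"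
proof -
  define y where "y = Q\<^sup>T *\<^sub>v x"
  have y: "y \<in> carrier_vec n" unfolding y_def using orth_matD[OF Q] x by simp
  have "K *\<^sub>v x = V *\<^sub>v (mat_diag n d *\<^sub>v y)"
    unfolding K y_def using orth_matD(1)[OF V] orth_matD(1)[OF Q] x
    by (simp add: assoc_mult_mat_vec[of _ n n _ n] mult_carrier_mat[of _ n n _ n])
  then have "(K *\<^sub>v x) \<bullet> (K *\<^sub>v x) = (mat_diag n d *\<^sub>v y) \<bullet> (mat_diag n d *\<^sub>v y)"
    using orth_mat_isometry[OF V, of "mat_diag n d *\<^sub>v y"] mult_mat_vec_carrier[OF mat_diag_dim y] by simp
  also have "\<dots> = (\<Sum>i = 0..<n. (d i)\<^sup>2 * (y $ i)\<^sup>2)"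
    unfolding mat_diag_mult_vec[OF y] by (subst scalar_prod_self_sum[of _ n]) (auto simp: power_mult_distrib)
  finally show ?thesis unfolding y_def .
qed

lemma svd_norm_le:
  assumes V: "orth_mat n V" and Q: "orth_mat n Q" and K: "K = V * mat_diag n d * Q\<^sup>T"
    and x: "x \<in> carrier_vec n" and d: "\<And>i. i < n \<Longrightarrow> 0 \<le> d i \<and> d i \<le> m"
  shows "(K *\<^sub>v x) \<bullet> (K *\<^sub>v x) \<le> m\<^sup>2 * (x \<bullet> x)"
proof -
  have y: "Q\<^sup>T *\<^sub>v x \<in> carrier_vec n" using orth_matD[OF Q] x by simp
  have "(K *\<^sub>v x) \<bullet> (K *\<^sub>v x) \<le> (\<Sum>i = 0..<n. m\<^sup>2 * ((Q\<^sup>T *\<^sub>v x) $ i)\<^sup>2)"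
    unfolding svd_norm[OF V Q K x] using d
    by (intro sum_mono mult_right_mono power_mono) auto
  also have "\<dots> = m\<^sup>2 * ((Q\<^sup>T *\<^sub>v x) \<bullet> (Q\<^sup>T *\<^sub>v x))"
    unfolding scalar_prod_self_sum[OF y] sum_distrib_left ..
  also have "\<dots> = m\<^sup>2 * (x \<bullet> x)" using orth_mat_isometry[OF orth_mat_transpose[OF Q] x] by simp
  finally show ?thesis .
qed

lemma spec_norm_le:
  assumes B: "B \<in> carrier_mat n n" and m: "0 \<le> m"
    and le: "\<And>x. x \<in> carrier_vec n \<Longrightarrow> (B *\<^sub>v x) \<bullet> (B *\<^sub>v x) \<le> m\<^sup>2 * (x \<bullet> x)"
  shows "spec_norm B \<le> m"
  unfolding spec_norm_def
proof (rule cSup_least)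
  fix t assume "t \<in> {0} \<union> {vnorm (B *\<^sub>v x) |x. x \<in> carrier_vec (dim_col B) \<and> vnorm x = 1}"
  then consider "t = 0" | x where "t = vnorm (B *\<^sub>v x)" "x \<in> carrier_vec n" "x \<bullet> x = 1"
    using B by (auto simp: vnorm_def)
  then show "t \<le> m"
  proof cases
    case 2
    then show ?thesis using le[of x] m by (simp add: vnorm_def scalar_prod_self_nonneg real_le_lsqrt)
  qed (use m in simp)
qed simp

text \<open>A supremum of reals bounds its set only if the set is bounded above; the largest
  singular value provides such a bound. The estimate for arbitrary vectors then follows by scaling
  to length one.\<close>

lemma spec_norm_bound:
  assumes B: "B \<in> carrier_mat n n"
  shows "0 \<le> spec_norm B"
    and "x \<in> carrier_vec n \<Longrightarrow> (B *\<^sub>v x) \<bullet> (B *\<^sub>v x) \<le> (spec_norm B)\<^sup>2 * (x \<bullet> x)"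
proof -
  let ?N = "{0} \<union> {vnorm (B *\<^sub>v x) |x. x \<in> carrier_vec (dim_col B) \<and> vnorm x = 1}"
  from singular_value_decomposition[OF B] obtain V d Q
    where V: "orth_mat n V" and Q: "orth_mat n Q" and d: "\<And>i. 0 \<le> d i"
      and Beq: "B = V * mat_diag n d * Q\<^sup>T" by auto
  \<comment> \<open>The inserted 0 keeps the set nonempty in dimension 0 and makes \<open>m\<close>
    nonnegative.\<close>
  define m where "m = Max (insert 0 (d ` {..<n}))"
  have m: "0 \<le> m" "\<And>i. i < n \<Longrightarrow> d i \<le> m" unfolding m_def by auto
  have bdd: "bdd_above ?N"
  proof (rule bdd_aboveI[of _ m])
    fix t assume "t \<in> ?N"
    then consider "t = 0" | x where "t = vnorm (B *\<^sub>v x)" "x \<in> carrier_vec n" "x \<bullet> x = 1"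
      using B by (auto simp: vnorm_def)
    then show "t \<le> m"
    proof cases
      case 2
      then show ?thesis using svd_norm_le[OF V Q Beq 2(2), of m] d m
        by (simp add: vnorm_def scalar_prod_self_nonneg real_le_lsqrt)
    qed (use m in simp)
  qed
  show nonneg: "0 \<le> spec_norm B" unfolding spec_norm_def by (rule cSup_upper[OF _ bdd]) simp
  assume x: "x \<in> carrier_vec n"
  show "(B *\<^sub>v x) \<bullet> (B *\<^sub>v x) \<le> (spec_norm B)\<^sup>2 * (x \<bullet> x)"
  proof (cases "x = 0\<^sub>v n")
    case True
    then have "B *\<^sub>v x = 0\<^sub>v n" using B by (intro eq_vecI) auto
    then show ?thesis using scalar_prod_self_nonneg[of x] by simp
  next
    case False
    define k where "k = inverse (sqrt (x \<bullet> x))"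
    have k: "k\<^sup>2 * (x \<bullet> x) = 1" "k > 0"
      unfolding k_def using scalar_prod_self_pos[OF x False] by (auto simp: power_inverse)
    have Bx: "B *\<^sub>v x \<in> carrier_vec n" using B x by simp
    have "vnorm (B *\<^sub>v (k \<cdot>\<^sub>v x)) \<le> spec_norm B"
      unfolding spec_norm_def using x B normalize_vec[OF x False, folded k_def]
      by (intro cSup_upper[OF _ bdd]) (auto simp: vnorm_def)
    then have "(vnorm (B *\<^sub>v (k \<cdot>\<^sub>v x)))\<^sup>2 \<le> (spec_norm B)\<^sup>2"
      by (intro power_mono) (auto simp: vnorm_def scalar_prod_self_nonneg)
    then have "k\<^sup>2 * ((B *\<^sub>v x) \<bullet> (B *\<^sub>v x)) \<le> (spec_norm B)\<^sup>2"
      using mult_mat_vec[OF B x, of k] Bx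
      by (simp add: vnorm_def scalar_prod_self_nonneg power2_eq_square mult.assoc)
    then have "(k\<^sup>2 * (x \<bullet> x)) * ((B *\<^sub>v x) \<bullet> (B *\<^sub>v x)) \<le> (spec_norm B)\<^sup>2 * (x \<bullet> x)"
      using mult_right_mono[OF _ scalar_prod_self_nonneg[of x]] by (metis mult.assoc mult.commute)
    then show ?thesis unfolding k(1) by simp
  qed
qed

section \<open>Polar decomposition and factors of Gram sums\<close>

text \<open>From K = V D Q^T one gets U = V Q^T and B = Q D Q^T. Applying the strict inequality to
  the columns of \<open>Q\<close> shows that every singular value is below one.\<close>

lemma contraction_polar_decomposition:
  assumes K: "K \<in> carrier_mat n n"
    and contr: "\<And>x. x \<in> carrier_vec n \<Longrightarrow> x \<noteq> 0\<^sub>v n \<Longrightarrow> (K *\<^sub>v x) \<bullet> (K *\<^sub>v x) < x \<bullet> x"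
  shows "\<exists>U B. orth_mat n U \<and> B \<in> carrier_mat n n \<and> B\<^sup>T = B \<and> psd_mat B \<and> spec_norm B < 1 \<and> K = U * B"
proof -
  from singular_value_decomposition[OF K] obtain V d Q
    where V: "orth_mat n V" and Q: "orth_mat n Q" and d: "\<And>i. 0 \<le> d i"
      and Keq: "K = V * mat_diag n d * Q\<^sup>T" by auto
  note V' = orth_matD[OF V] and Q' = orth_matD[OF Q]
  have d1: "d i < 1" if i: "i < n" for i
  proof -
    \<comment> \<open>The right singular vector that belongs to \<open>d i\<close>: its image under
      \<open>K\<close> has length \<open>d i\<close>.\<close>
    let ?x = "Q *\<^sub>v unit_vec n i"
    have x: "?x \<in> carrier_vec n" using Q' i by simp
    have x1: "?x \<bullet> ?x = 1" using orth_mat_isometry[OF Q, of "unit_vec n i"] i by simp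
    then have "?x \<noteq> 0\<^sub>v n" by auto
    have "Q\<^sup>T *\<^sub>v ?x = (Q\<^sup>T * Q) *\<^sub>v unit_vec n i"
      using Q'(1) i by (simp add: assoc_mult_mat_vec[of _ n n _ n])
    then have "Q\<^sup>T *\<^sub>v ?x = unit_vec n i" using Q' i by simp
    then have "(K *\<^sub>v ?x) \<bullet> (K *\<^sub>v ?x) = (\<Sum>j = 0..<n. (d j)\<^sup>2 * (unit_vec n i $ j)\<^sup>2)"
      unfolding svd_norm[OF V Q Keq x] by simp
    also have "\<dots> = (\<Sum>j = 0..<n. if i = j then (d j)\<^sup>2 else 0)"
      using i by (intro sum.cong) auto
    finally have "(K *\<^sub>v ?x) \<bullet> (K *\<^sub>v ?x) = (\<Sum>j = 0..<n. if i = j then (d j)\<^sup>2 else 0)" .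
    then have "(d i)\<^sup>2 < 1" using contr[OF x \<open>?x \<noteq> 0\<^sub>v n\<close>] x1 i by simp
    then show ?thesis using d[of i] by (metis abs_of_nonneg abs_square_less_1)
  qed
  \<comment> \<open>A maximum of finitely many numbers below one is itself below one. This turns the
    pointwise strict bounds into a strict bound on the norm.\<close>
  define m where "m = Max (insert 0 (d ` {..<n}))"
  have m: "0 \<le> m" "m < 1" "\<And>i. i < n \<Longrightarrow> d i \<le> m" unfolding m_def using d1 by auto
  define B where "B = Q * mat_diag n d * Q\<^sup>T"
  have B: "B \<in> carrier_mat n n" unfolding B_def using Q'(1) by (auto simp: mult_carrier_mat[of _ n n _ n])
  have DT: "(mat_diag n d)\<^sup>T = mat_diag n d" unfolding mat_diag_def by (rule eq_matI) auto
  have "B\<^sup>T = B"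
    unfolding B_def using Q'(1)
    by (simp add: transpose_mult[of _ n n _ n] mult_carrier_mat[of _ n n _ n] DT assoc_mult_mat[of _ n n _ n _ n])
  moreover have "psd_mat B"
    unfolding psd_mat_def
  proof
    fix x :: "real vec" assume "x \<in> carrier_vec (dim_row B)"
    then have x: "x \<in> carrier_vec n" using B by simp
    define y where "y = Q\<^sup>T *\<^sub>v x"
    have y: "y \<in> carrier_vec n" unfolding y_def using Q' x by simp
    have Dy: "mat_diag n d *\<^sub>v y \<in> carrier_vec n" using mult_mat_vec_carrier[OF mat_diag_dim y] .
    have "B *\<^sub>v x = Q *\<^sub>v (mat_diag n d *\<^sub>v y)"
      unfolding B_def y_def using Q'(1) x
      by (simp add: assoc_mult_mat_vec[of _ n n _ n] mult_carrier_mat[of _ n n _ n])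
    then have "x \<bullet> (B *\<^sub>v x) = y \<bullet> (mat_diag n d *\<^sub>v y)"
      unfolding y_def using scalar_prod_mult_mat_vec[of "Q\<^sup>T" n n x "mat_diag n d *\<^sub>v y"] Q'(1) x Dy
      unfolding y_def by simp
    also have "\<dots> = (\<Sum>i = 0..<n. d i * (y $ i)\<^sup>2)"
      unfolding mat_diag_mult_vec[OF y] by (auto simp: scalar_prod_def power2_eq_square ac_simps)
    also have "\<dots> \<ge> 0" using d by (intro sum_nonneg) auto
    finally show "0 \<le> x \<bullet> (B *\<^sub>v x)" .
  qed
  \<comment> \<open>The definition of \<open>B\<close> is itself a singular value decomposition,
    with \<open>Q\<close> on both sides.\<close>
  moreover have "spec_norm B \<le> m"
    using svd_norm_le[OF Q Q B_def _] d m by (intro spec_norm_le[OF B m(1)]) auto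
  moreover have "K = (V * Q\<^sup>T) * B"
  proof -
    have "(V * Q\<^sup>T) * B = V * ((Q\<^sup>T * Q) * (mat_diag n d * Q\<^sup>T))"
      unfolding B_def using V'(1) Q'(1)
      by (simp add: mult_carrier_mat[of _ n n _ n] assoc_mult_mat[of _ n n _ n _ n])
    also have "\<dots> = K" unfolding Keq Q'(2) using V'(1) Q'(1)
      by (simp add: mult_carrier_mat[of _ n n _ n] assoc_mult_mat[of _ n n _ n _ n] left_mult_one_mat[of _ n n])
    finally show ?thesis by simp
  qed
  ultimately show ?thesis
    using orth_mat_mult[OF V orth_mat_transpose[OF Q]] B m(2)
    by (intro exI[of _ "V * Q\<^sup>T"] exI[of _ B]) auto
qed

text \<open>If $M = V D Q^T$ is a singular value decomposition, then $S = (1 + D^2)^{1/2} Q^T$ works.\<close>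

lemma one_plus_gram_factor:
  fixes M :: "real mat"
  assumes M: "M \<in> carrier_mat n n"
  shows "\<exists>S S'. S \<in> carrier_mat n n \<and> S' \<in> carrier_mat n n \<and> S * S' = 1\<^sub>m n \<and> S' * S = 1\<^sub>m n \<and>
    (\<forall>x \<in> carrier_vec n. (S *\<^sub>v x) \<bullet> (S *\<^sub>v x) = x \<bullet> x + (M *\<^sub>v x) \<bullet> (M *\<^sub>v x))"
proof -
  from singular_value_decomposition[OF M] obtain V d Q
    where V: "orth_mat n V" and Q: "orth_mat n Q" and Meq: "M = V * mat_diag n d * Q\<^sup>T" by auto
  note Q' = orth_matD[OF Q]
  define f where "f i = sqrt (1 + (d i)\<^sup>2)" for i
  have f: "(f i)\<^sup>2 = 1 + (d i)\<^sup>2" "f i \<noteq> 0" for i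
    unfolding f_def using sum_power2_eq_zero_iff[of 1 "d i"] by (auto simp: add_nonneg_nonneg)
  define S where "S = mat_diag n f * Q\<^sup>T"
  define S' where "S' = Q * mat_diag n (\<lambda>i. inverse (f i))"
  have S: "S \<in> carrier_mat n n" "S' \<in> carrier_mat n n" unfolding S_def S'_def using Q'(1) by (auto simp: mult_carrier_mat[of _ n n _ n])
  have "S * S' = mat_diag n f * ((Q\<^sup>T * Q) * mat_diag n (\<lambda>i. inverse (f i)))"
    unfolding S_def S'_def using Q'(1)
    by (simp add: mult_carrier_mat[of _ n n _ n] assoc_mult_mat[of _ n n _ n _ n])
  then have "S * S' = 1\<^sub>m n" unfolding Q'(2) by (simp add: left_mult_one_mat[of _ n n] f)
  moreover have "(S *\<^sub>v x) \<bullet> (S *\<^sub>v x) = x \<bullet> x + (M *\<^sub>v x) \<bullet> (M *\<^sub>v x)"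
    if x: "x \<in> carrier_vec n" for x
  proof -
    have y: "Q\<^sup>T *\<^sub>v x \<in> carrier_vec n" using Q' x by simp
    have I: "orth_mat n (1\<^sub>m n)" unfolding orth_mat_def by simp
    \<comment> \<open>The identity is inserted as left orthogonal factor to give \<open>S\<close>
      the shape of a singular value decomposition.\<close>
    have "S = 1\<^sub>m n * mat_diag n f * Q\<^sup>T"
      unfolding S_def by (simp add: left_mult_one_mat[of _ n n])
    from svd_norm[OF I Q this x]
    have "(S *\<^sub>v x) \<bullet> (S *\<^sub>v x) = (Q\<^sup>T *\<^sub>v x) \<bullet> (Q\<^sup>T *\<^sub>v x) + (M *\<^sub>v x) \<bullet> (M *\<^sub>v x)"
      unfolding svd_norm[OF V Q Meq x] scalar_prod_self_sum[OF y] f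
      by (simp add: algebra_simps sum.distrib)
    then show ?thesis using orth_mat_isometry[OF orth_mat_transpose[OF Q] x] by simp
  qed
  ultimately show ?thesis using S mat_mult_left_right_inverse[OF S]
    by (intro exI[of _ S] exI[of _ S']) auto
qed

text \<open>The sum up to \<open>Suc k\<close> at \<open>x\<close> is \<open>x \<bullet> x\<close>
  plus the sum up to \<open>k\<close> at \<open>J *\<^sub>v x\<close>. If \<open>S\<close>
  represents the latter sum, then the new factor is obtained from
  \<open>one_plus_gram_factor\<close> applied to \<open>S * J\<close>.\<close>

lemma power_gram_sum_factor:
  fixes J :: "real mat"
  assumes J: "J \<in> carrier_mat n n"
  shows "\<exists>S S'. S \<in> carrier_mat n n \<and> S' \<in> carrier_mat n n \<and> S * S' = 1\<^sub>m n \<and> S' * S = 1\<^sub>m n \<and>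
    (\<forall>x \<in> carrier_vec n. (S *\<^sub>v x) \<bullet> (S *\<^sub>v x) = (\<Sum>j\<le>k. ((J ^\<^sub>m j) *\<^sub>v x) \<bullet> ((J ^\<^sub>m j) *\<^sub>v x)))"
proof (induction k)
  case 0
  then show ?case using J by (intro exI[of _ "1\<^sub>m n"]) auto
next
  case (Suc k)
  then obtain S where S: "S \<in> carrier_mat n n"
    and SS: "\<And>x. x \<in> carrier_vec n \<Longrightarrow>
      (S *\<^sub>v x) \<bullet> (S *\<^sub>v x) = (\<Sum>j\<le>k. ((J ^\<^sub>m j) *\<^sub>v x) \<bullet> ((J ^\<^sub>m j) *\<^sub>v x))" by auto
  from one_plus_gram_factor[OF mult_carrier_mat[OF S J]] obtain R R'
    where R: "R \<in> carrier_mat n n" "R' \<in> carrier_mat n n" "R * R' = 1\<^sub>m n" "R' * R = 1\<^sub>m n"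
      and RR: "\<And>x. x \<in> carrier_vec n \<Longrightarrow>
        (R *\<^sub>v x) \<bullet> (R *\<^sub>v x) = x \<bullet> x + (S * J *\<^sub>v x) \<bullet> (S * J *\<^sub>v x)" by auto
  have "(R *\<^sub>v x) \<bullet> (R *\<^sub>v x) = (\<Sum>j\<le>Suc k. ((J ^\<^sub>m j) *\<^sub>v x) \<bullet> ((J ^\<^sub>m j) *\<^sub>v x))"
    if x: "x \<in> carrier_vec n" for x
  proof -
    have Jx: "J *\<^sub>v x \<in> carrier_vec n" using J x by simp
    have "(J ^\<^sub>m Suc j) *\<^sub>v x = (J ^\<^sub>m j) *\<^sub>v (J *\<^sub>v x)" for j
      using J x by (simp add: assoc_mult_mat_vec[of _ n n _ n])
    moreover have "S * J *\<^sub>v x = S *\<^sub>v (J *\<^sub>v x)" using S J x by (simp add: assoc_mult_mat_vec[of _ n n _ n])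
    ultimately show ?thesis
      unfolding RR[OF x] sum.atMost_Suc_shift using SS[OF Jx] J x by simp
  qed
  then show ?case using R by (intro exI[of _ R] exI[of _ R']) auto
qed

section \<open>Decay of powers and the Lyapunov function\<close>

lemma mult_mat_zero_vec:
  "(A :: 'a :: semiring_0 mat) \<in> carrier_mat nr nc \<Longrightarrow> A *\<^sub>v 0\<^sub>v nc = 0\<^sub>v nr"
  by (intro eq_vecI) auto

lemma smult_pow_mat:
  fixes A :: "'a :: comm_semiring_1 mat"
  assumes A: "A \<in> carrier_mat n n"
  shows "(t \<cdot>\<^sub>m A) ^\<^sub>m k = t ^ k \<cdot>\<^sub>m A ^\<^sub>m k"
proof (induction k)
  case 0
  show ?case by (rule eq_matI) (use A in auto)
next
  case (Suc k)
  have Ak: "A ^\<^sub>m k \<in> carrier_mat n n" using A by simp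
  have "(t \<cdot>\<^sub>m A) ^\<^sub>m Suc k = t ^ k \<cdot>\<^sub>m (t \<cdot>\<^sub>m (A ^\<^sub>m k * A))"
    using Suc mult_smult_assoc_mat[of "A ^\<^sub>m k" n n "t \<cdot>\<^sub>m A" n "t ^ k"]
      mult_smult_distrib[OF Ak A] Ak A by simp
  moreover have "t ^ k \<cdot>\<^sub>m (t \<cdot>\<^sub>m (A ^\<^sub>m k * A)) = t ^ Suc k \<cdot>\<^sub>m A ^\<^sub>m Suc k"
    by (rule eq_matI) (auto simp: ac_simps)
  ultimately show ?case by simp
qed

text \<open>There is room to scale \<open>J\<close> by some \<open>t > 1\<close> and keep the
  spectral radius below one. The powers of the scaled matrix stay bounded, so those of
  \<open>J\<close> decay like the powers of \<open>inverse t\<close>.\<close>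

lemma stable_powers_decay:
  assumes J: "J \<in> carrier_mat n n"
    and stable: "\<And>z. eigenvalue (map_mat complex_of_real J) z \<Longrightarrow> cmod z < 1"
    and e: "0 < e"
  shows "\<exists>k. \<forall>i<n. \<forall>j<n. \<bar>(J ^\<^sub>m Suc k) $$ (i, j)\<bar> < e"
proof (cases "n = 0")
  case True
  then show ?thesis by simp
next
  case False
  then have n: "0 < n" by simp
  define C where "C = map_mat complex_of_real J"
  have C: "C \<in> carrier_mat n n" unfolding C_def using J by simp
  define \<rho> where "\<rho> = spectral_radius C"
  from spectral_radius_mem_max(1)[OF C n] have \<rho>: "0 \<le> \<rho>" "\<rho> < 1"
    unfolding \<rho>_def spectrum_def using stable[folded C_def] by auto
  \<comment> \<open>Since \<rho> < 1, both \<open>t > 1\<close> and t \<rho> = 2 \<rho> / (1 +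
    \<rho>) < 1 hold.\<close>
  define t where "t = 2 / (1 + \<rho>)"
  have t: "t > 1" "t * \<rho> < 1" unfolding t_def using \<rho> by (auto simp: field_simps)
  define T where "T = complex_of_real t \<cdot>\<^sub>m C"
  have T: "T \<in> carrier_mat n n" unfolding T_def using C by simp
  have "cmod w < 1" if w: "w \<in> spectrum T" for w
  proof -
    from w obtain x where x: "x \<in> carrier_vec n" "x \<noteq> 0\<^sub>v n" and Tx: "T *\<^sub>v x = w \<cdot>\<^sub>v x"
      using T unfolding spectrum_def eigenvalue_def eigenvector_def by auto
    have "C *\<^sub>v x = (w / complex_of_real t) \<cdot>\<^sub>v x"
    proof (rule eq_vecI)
      fix i assume "i < dim_vec ((w / complex_of_real t) \<cdot>\<^sub>v x)"
      then have i: "i < n" using x by simp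
      have "complex_of_real t * (C *\<^sub>v x) $ i = w * x $ i"
        using arg_cong[OF Tx, of "\<lambda>v. v $ i"] i x C unfolding T_def by simp
      then show "(C *\<^sub>v x) $ i = ((w / complex_of_real t) \<cdot>\<^sub>v x) $ i"
        using i x C t by (simp add: field_simps)
    qed (use C x in simp)
    then have "w / complex_of_real t \<in> spectrum C"
      using x C unfolding spectrum_def eigenvalue_def eigenvector_def by auto
    then have "cmod (w / complex_of_real t) \<le> \<rho>"
      unfolding \<rho>_def by (intro spectral_radius_mem_max(2)[OF C n]) auto
    then have "cmod w \<le> t * \<rho>" using t by (simp add: norm_divide field_simps)
    then show ?thesis using t by simp
  qed
  then have "spectral_radius T < 1" using spectral_radius_mem_max(1)[OF T n] by auto
  from spectral_radius_jnf_norm_bound_less_1_upper_triangular[OF T this]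
  obtain c where c: "\<And>k. norm_bound (T ^\<^sub>m k) c" by auto
  \<comment> \<open>Adding 1 to the absolute value of \<open>c\<close> keeps the divisor positive.
    The exponent \<open>Suc k\<close> is reached later because \<open>inverse t\<close> is less than
    one.\<close>
  obtain k where k: "inverse t ^ k < e / (\<bar>c\<bar> + 1)"
    using real_arch_pow_inv[of "e / (\<bar>c\<bar> + 1)" "inverse t"] e t by (auto simp: inverse_less_1_iff)
  have "\<bar>(J ^\<^sub>m Suc k) $$ (i, j)\<bar> < e" if ij: "i < n" "j < n" for i j
  proof -
    have "T ^\<^sub>m Suc k = complex_of_real t ^ Suc k \<cdot>\<^sub>m map_mat complex_of_real (J ^\<^sub>m Suc k)"
      unfolding T_def C_def of_real_hom.mat_hom_pow[OF J] using J by (intro smult_pow_mat) auto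
    then have "(T ^\<^sub>m Suc k) $$ (i, j) = complex_of_real (t ^ Suc k * (J ^\<^sub>m Suc k) $$ (i, j))"
      using ij J pow_carrier_mat[OF J, of "Suc k"] by (simp del: pow_mat.simps)
    moreover have "cmod ((T ^\<^sub>m Suc k) $$ (i, j)) \<le> c"
      using c[of "Suc k"] ij T pow_carrier_mat[OF T, of "Suc k"] unfolding norm_bound_def
      by (auto simp del: pow_mat.simps)
    ultimately have "t ^ Suc k * \<bar>(J ^\<^sub>m Suc k) $$ (i, j)\<bar> \<le> c"
      using t by (simp only: norm_of_real abs_mult) simp
    then have "\<bar>(J ^\<^sub>m Suc k) $$ (i, j)\<bar> \<le> c * inverse t ^ Suc k"
      using t by (simp add: field_simps)
    also have "\<dots> \<le> (\<bar>c\<bar> + 1) * inverse t ^ k"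
    proof (rule mult_mono)
      show "inverse t ^ Suc k \<le> inverse t ^ k"
        using t by (intro power_decreasing) (auto simp: inverse_le_1_iff)
    qed (use t in auto)
    also have "\<dots> < e" using k by (simp add: field_simps)
    finally show ?thesis .
  qed
  then show ?thesis by blast
qed

text \<open>Each coordinate of the image is at most \<open>e\<close> times the sum of the absolute
  values in \<open>x\<close>, whose square is at most \<open>n\<close> times
  \<open>x \<bullet> x\<close>. Summing over the rows contributes the second factor
  \<open>n\<close>.\<close>

lemma norm_mult_mat_vec_entry_bound:
  fixes A :: "real mat"
  assumes A: "A \<in> carrier_mat n n" and x: "x \<in> carrier_vec n"
    and e: "\<And>i j. i < n \<Longrightarrow> j < n \<Longrightarrow> \<bar>A $$ (i, j)\<bar> \<le> e"
  shows "(A *\<^sub>v x) \<bullet> (A *\<^sub>v x) \<le> (real n * e)\<^sup>2 * (x \<bullet> x)"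
proof -
  let ?s = "\<Sum>j = 0..<n. \<bar>x $ j\<bar>"
  have "?s * ?s = (\<Sum>i = 0..<n. \<Sum>j = 0..<n. \<bar>x $ i\<bar> * \<bar>x $ j\<bar>)" by (rule sum_product)
  \<comment> \<open>Arithmetic-geometric mean inequality for each pair of entries, which gives
    Cauchy-Schwarz against the all-ones vector.\<close>
  also have "\<dots> \<le> (\<Sum>i = 0..<n. \<Sum>j = 0..<n. ((x $ i)\<^sup>2 + (x $ j)\<^sup>2) / 2)"
    using sum_squares_bound[of "\<bar>x $ i\<bar>" "\<bar>x $ j\<bar>" for i j]
    by (intro sum_mono) (auto simp: field_simps)
  also have "\<dots> = real n * (x \<bullet> x)"
    unfolding scalar_prod_self_sum[OF x]
    by (simp add: add_divide_distrib sum.distrib flip: sum_divide_distrib sum_distrib_left)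
  finally have s: "?s\<^sup>2 \<le> real n * (x \<bullet> x)" by (simp add: power2_eq_square)
  have row: "((A *\<^sub>v x) $ i)\<^sup>2 \<le> e\<^sup>2 * (real n * (x \<bullet> x))" if i: "i < n" for i
  proof -
    have e0: "0 \<le> e" using e[OF i i] by linarith
    have "(A *\<^sub>v x) $ i = (\<Sum>j = 0..<n. A $$ (i, j) * x $ j)"
      using A x i by (simp add: scalar_prod_def)
    also have "\<bar>\<dots>\<bar> \<le> (\<Sum>j = 0..<n. e * \<bar>x $ j\<bar>)"
      using e[OF i] by (intro order_trans[OF sum_abs] sum_mono) (auto simp: abs_mult intro!: mult_right_mono)
    finally have "\<bar>(A *\<^sub>v x) $ i\<bar> \<le> e * ?s" by (simp add: sum_distrib_left)
    then have "((A *\<^sub>v x) $ i)\<^sup>2 \<le> (e * ?s)\<^sup>2"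
      using power_mono[of "\<bar>(A *\<^sub>v x) $ i\<bar>" "e * ?s" 2] by simp
    also have "\<dots> \<le> e\<^sup>2 * (real n * (x \<bullet> x))"
      unfolding power_mult_distrib using s by (intro mult_left_mono) auto
    finally show ?thesis .
  qed
  have Ax: "A *\<^sub>v x \<in> carrier_vec n" using A x by simp
  have "(A *\<^sub>v x) \<bullet> (A *\<^sub>v x) \<le> (\<Sum>i = 0..<n. e\<^sup>2 * (real n * (x \<bullet> x)))"
    unfolding scalar_prod_self_sum[OF Ax] using row by (intro sum_mono) simp
  then show ?thesis by (simp add: power2_eq_square algebra_simps)
qed

text \<open>Passing from \<open>x\<close> to \<open>J *\<^sub>v x\<close> in the Lyapunov sum
  removes the term \<open>x \<bullet> x\<close> and adds the squared length of the image of
  \<open>x\<close> under \<open>J ^\<^sub>m Suc k\<close>, which is smaller. In the coordinates y =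
  S x this says that S J S^(-1) shrinks every nonzero vector.\<close>

lemma stable_similar_contraction:
  assumes J: "J \<in> carrier_mat n n"
    and stable: "\<And>z. eigenvalue (map_mat complex_of_real J) z \<Longrightarrow> cmod z < 1"
  shows "\<exists>S S'. S \<in> carrier_mat n n \<and> S' \<in> carrier_mat n n \<and> S * S' = 1\<^sub>m n \<and> S' * S = 1\<^sub>m n \<and>
    (\<forall>y \<in> carrier_vec n. y \<noteq> 0\<^sub>v n \<longrightarrow> (S * J * S' *\<^sub>v y) \<bullet> (S * J * S' *\<^sub>v y) < y \<bullet> y)"
proof -
  \<comment> \<open>Entries below \<open>e\<close> make the matrix a contraction, by the factor
    \<open>real n * e\<close>; the added 1 keeps this factor below one and the denominator
    positive.\<close>
  define e where "e = 1 / (real n + 1)"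
  have e: "0 < e" "real n * e < 1" unfolding e_def by (auto simp: field_simps)
  from stable_powers_decay[OF J stable e(1)] obtain k
    where k: "\<And>i j. i < n \<Longrightarrow> j < n \<Longrightarrow> \<bar>(J ^\<^sub>m Suc k) $$ (i, j)\<bar> < e" by blast
  from power_gram_sum_factor[OF J, of k] obtain S S'
    where S: "S \<in> carrier_mat n n" "S' \<in> carrier_mat n n" "S * S' = 1\<^sub>m n" "S' * S = 1\<^sub>m n"
      and SS: "\<And>x. x \<in> carrier_vec n \<Longrightarrow>
        (S *\<^sub>v x) \<bullet> (S *\<^sub>v x) = (\<Sum>j\<le>k. ((J ^\<^sub>m j) *\<^sub>v x) \<bullet> ((J ^\<^sub>m j) *\<^sub>v x))" by blast
  have "(S * J * S' *\<^sub>v y) \<bullet> (S * J * S' *\<^sub>v y) < y \<bullet> y"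
    if y: "y \<in> carrier_vec n" "y \<noteq> 0\<^sub>v n" for y
  proof -
    define x where "x = S' *\<^sub>v y"
    have x: "x \<in> carrier_vec n" unfolding x_def using S y by simp
    have "S *\<^sub>v x = (S * S') *\<^sub>v y"
      unfolding x_def using S(1,2) y by (simp add: assoc_mult_mat_vec[of _ n n _ n])
    then have Sx: "S *\<^sub>v x = y" using S(3) y by simp
    then have "x \<noteq> 0\<^sub>v n" using y S(1) by auto
    then have xpos: "0 < x \<bullet> x" by (rule scalar_prod_self_pos[OF x])
    let ?p = "\<lambda>j. ((J ^\<^sub>m j) *\<^sub>v x) \<bullet> ((J ^\<^sub>m j) *\<^sub>v x)"
    have Jx: "J *\<^sub>v x \<in> carrier_vec n" using J x by simp
    have p: "(J ^\<^sub>m j) *\<^sub>v (J *\<^sub>v x) = (J ^\<^sub>m Suc j) *\<^sub>v x" for j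
      using J x by (simp add: assoc_mult_mat_vec[of _ n n _ n])
    have "S * J * S' *\<^sub>v y = S *\<^sub>v (J *\<^sub>v x)"
      unfolding x_def using S(1,2) J y
      by (simp add: assoc_mult_mat_vec[of _ n n _ n] mult_carrier_mat[of _ n n _ n])
    then have "(S * J * S' *\<^sub>v y) \<bullet> (S * J * S' *\<^sub>v y) = (\<Sum>j\<le>k. ?p (Suc j))"
      using SS[OF Jx] unfolding p by simp
    \<comment> \<open>The shifted sum differs from the original one only in its two end
      terms.\<close>
    also have "\<dots> = (\<Sum>j\<le>k. ?p j) - x \<bullet> x + ?p (Suc k)"
      using sum.atMost_Suc_shift[of ?p k] sum.atMost_Suc[of ?p k] J x by (simp del: pow_mat.simps(2))
    also have "(\<Sum>j\<le>k. ?p j) = y \<bullet> y" using SS[OF x] unfolding Sx by simp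
    also have "y \<bullet> y - x \<bullet> x + ?p (Suc k) < y \<bullet> y"
    proof -
      have "?p (Suc k) \<le> (real n * e)\<^sup>2 * (x \<bullet> x)"
        using k by (intro norm_mult_mat_vec_entry_bound[OF pow_carrier_mat[OF J] x] less_imp_le)
      also have "\<dots> < 1 * (x \<bullet> x)"
        using xpos e by (intro mult_strict_right_mono) (auto simp: abs_square_less_1)
      finally show ?thesis by simp
    qed
    finally show ?thesis .
  qed
  then show ?thesis using S by blast
qed

section \<open>Stability and the factorization into orthogonal and contractive parts\<close>

lemma stable_decomposition:
  assumes J: "J \<in> carrier_mat n n"
    and stable: "\<And>z. eigenvalue (map_mat complex_of_real J) z \<Longrightarrow> cmod z < 1"
  shows "\<exists>S S' U B. S \<in> carrier_mat n n \<and> S' \<in> carrier_mat n n \<and> S * S' = 1\<^sub>m n \<and> S' * S = 1\<^sub>m n \<and>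
    orth_mat n U \<and> B \<in> carrier_mat n n \<and> B\<^sup>T = B \<and> psd_mat B \<and> spec_norm B < 1 \<and> J = S' * U * B * S"
proof -
  from stable_similar_contraction[OF J stable] obtain S S'
    where S: "S \<in> carrier_mat n n" "S' \<in> carrier_mat n n" "S * S' = 1\<^sub>m n" "S' * S = 1\<^sub>m n"
      and contr: "\<And>y. y \<in> carrier_vec n \<Longrightarrow> y \<noteq> 0\<^sub>v n \<Longrightarrow>
        (S * J * S' *\<^sub>v y) \<bullet> (S * J * S' *\<^sub>v y) < y \<bullet> y" by blast
  have K: "S * J * S' \<in> carrier_mat n n" using S J by (simp add: mult_carrier_mat[of _ n n _ n])
  from contraction_polar_decomposition[OF K contr] obtain U B
    where UB: "orth_mat n U" "B \<in> carrier_mat n n" "B\<^sup>T = B" "psd_mat B" "spec_norm B < 1"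
      and eq: "S * J * S' = U * B" by auto
  note U = orth_matD(1)[OF UB(1)]
  have "S' * U * B * S = S' * (S * J * S') * S"
    unfolding eq using S(1,2) U UB(2) by (simp add: mult_carrier_mat[of _ n n _ n] assoc_mult_mat[of _ n n _ n _ n])
  also have "\<dots> = (S' * S) * J * (S' * S)"
    using S(1,2) J by (simp add: mult_carrier_mat[of _ n n _ n] assoc_mult_mat[of _ n n _ n _ n])
  also have "\<dots> = J" unfolding S(4) using J by simp
  finally show ?thesis using S UB by (intro exI[of _ S] exI[of _ S'] exI[of _ U] exI[of _ B]) auto
qed

text \<open>Measured by the length of \<open>S *\<^sub>v x\<close>, the matrix \<open>J\<close>
  contracts by the factor \<open>spec_norm B\<close>, as \<open>U\<close> preserves lengths. On the
  plane of an eigenvector the squared lengths of the images of \<open>a\<close> and \<open>b\<close>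
  add up to the squared modulus of \<open>z\<close> times the original total.\<close>

lemma decomposition_stable:
  assumes S: "S \<in> carrier_mat n n" "S' \<in> carrier_mat n n" "S * S' = 1\<^sub>m n" "S' * S = 1\<^sub>m n"
    and U: "orth_mat n U" and B: "B \<in> carrier_mat n n" "spec_norm B < 1"
    and ev: "eigenvalue (map_mat complex_of_real (S' * U * B * S)) z"
  shows "cmod z < 1"
proof -
  define J where "J = S' * U * B * S"
  note U' = orth_matD(1)[OF U]
  have J: "J \<in> carrier_mat n n" unfolding J_def using S U' B by (simp add: mult_carrier_mat[of _ n n _ n])
  from complex_eigenvalue_real_parts[OF J ev[folded J_def]] obtain a b
    where a: "a \<in> carrier_vec n" and b: "b \<in> carrier_vec n" and ab: "a \<noteq> 0\<^sub>v n \<or> b \<noteq> 0\<^sub>v n"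
      and Ja: "J *\<^sub>v a = Re z \<cdot>\<^sub>v a - Im z \<cdot>\<^sub>v b" and Jb: "J *\<^sub>v b = Im z \<cdot>\<^sub>v a + Re z \<cdot>\<^sub>v b" .
  define p where "p = S *\<^sub>v a"
  define q where "q = S *\<^sub>v b"
  have p: "p \<in> carrier_vec n" and q: "q \<in> carrier_vec n" unfolding p_def q_def using S a b by auto
  have inv: "S' *\<^sub>v (S *\<^sub>v x) = x" if "x \<in> carrier_vec n" for x
    using assoc_mult_mat_vec[OF S(2,1) that] S(4) that by simp
  have pq: "p \<noteq> 0\<^sub>v n \<or> q \<noteq> 0\<^sub>v n"
    using ab inv[OF a] inv[OF b] mult_mat_zero_vec[OF S(2)] unfolding p_def q_def by auto
  have SJ: "(B *\<^sub>v (S *\<^sub>v x)) \<bullet> (B *\<^sub>v (S *\<^sub>v x)) = (S *\<^sub>v (J *\<^sub>v x)) \<bullet> (S *\<^sub>v (J *\<^sub>v x))"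
    if x: "x \<in> carrier_vec n" for x
  proof -
    have BSx: "B *\<^sub>v (S *\<^sub>v x) \<in> carrier_vec n" using B S x by simp
    have "S * J = (S * S') * (U * (B * S))"
      unfolding J_def using S(1,2) U' B(1)
      by (simp add: mult_carrier_mat[of _ n n _ n] assoc_mult_mat[of _ n n _ n _ n])
    also have "\<dots> = U * (B * S)"
      unfolding S(3) using S(1) U' B(1) by (simp add: mult_carrier_mat[of _ n n _ n] left_mult_one_mat[of _ n n])
    finally have "S *\<^sub>v (J *\<^sub>v x) = (U * (B * S)) *\<^sub>v x"
      using assoc_mult_mat_vec[OF S(1) J x] by simp
    also have "\<dots> = U *\<^sub>v (B *\<^sub>v (S *\<^sub>v x))"
      using S(1) U' B(1) x by (simp add: mult_carrier_mat[of _ n n _ n] assoc_mult_mat_vec[of _ n n _ n])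
    finally show ?thesis using orth_mat_isometry[OF U BSx] by simp
  qed
  have Sa: "S *\<^sub>v (J *\<^sub>v a) = Re z \<cdot>\<^sub>v p - Im z \<cdot>\<^sub>v q"
    unfolding Ja p_def q_def using S(1) a b
    by (simp add: mult_minus_distrib_mat_vec[of _ n n] mult_mat_vec[of _ n n])
  have Sb: "S *\<^sub>v (J *\<^sub>v b) = Im z \<cdot>\<^sub>v p + Re z \<cdot>\<^sub>v q"
    unfolding Jb p_def q_def using S(1) a b
    by (simp add: mult_add_distrib_mat_vec[of _ n n] mult_mat_vec[of _ n n])
  let ?N = "p \<bullet> p + q \<bullet> q"
  \<comment> \<open>The mixed terms in \<open>p \<bullet> q\<close> have opposite signs in the two
    squares and cancel in the sum.\<close>
  have "(S *\<^sub>v (J *\<^sub>v a)) \<bullet> (S *\<^sub>v (J *\<^sub>v a)) + (S *\<^sub>v (J *\<^sub>v b)) \<bullet> (S *\<^sub>v (J *\<^sub>v b)) = ((Re z)\<^sup>2 + (Im z)\<^sup>2) * ?N"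
    unfolding Sa Sb using p q comm_scalar_prod[OF p q]
    by (simp add: minus_scalar_prod_distrib[of _ n] scalar_prod_minus_distrib[of _ n]
        add_scalar_prod_distrib[of _ n] scalar_prod_add_distrib[of _ n] power2_eq_square algebra_simps)
  then have "((Re z)\<^sup>2 + (Im z)\<^sup>2) * ?N = (B *\<^sub>v p) \<bullet> (B *\<^sub>v p) + (B *\<^sub>v q) \<bullet> (B *\<^sub>v q)"
    using SJ[OF a] SJ[OF b] unfolding p_def q_def by simp
  also have "\<dots> \<le> (spec_norm B)\<^sup>2 * ?N"
    using spec_norm_bound(2)[OF B(1) p] spec_norm_bound(2)[OF B(1) q] by (simp add: algebra_simps)
  finally have "((Re z)\<^sup>2 + (Im z)\<^sup>2) * ?N \<le> (spec_norm B)\<^sup>2 * ?N" .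
  moreover have "?N > 0"
    using pq scalar_prod_self_pos[OF p] scalar_prod_self_pos[OF q]
      scalar_prod_self_nonneg[of p] scalar_prod_self_nonneg[of q] by linarith
  ultimately have "(cmod z)\<^sup>2 \<le> (spec_norm B)\<^sup>2" by (simp add: cmod_power2)
  then have "cmod z \<le> spec_norm B" using spec_norm_bound(1)[OF B(1)] by (rule power2_le_imp_le)
  then show ?thesis using B(2) by simp
qed

section \<open>Block pencils: eigenvalues, regularity and rank\<close>

lemma invertible_mat_det_nonzero:
  fixes W :: "'a :: field mat"
  assumes "W \<in> carrier_mat n n" "invertible_mat W"
  shows "det W \<noteq> 0"
proof -
  from assms obtain V where V: "W * V = 1\<^sub>m n" "V * W = 1\<^sub>m (dim_row V)"
    unfolding invertible_mat_def inverts_mat_def by auto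
  \<comment> \<open>\<open>invertible_mat\<close> leaves the size of the inverse open; it is read
    off from the column counts of the two products.\<close>
  have "V \<in> carrier_mat n n"
    using arg_cong[OF V(1), of dim_col] arg_cong[OF V(2), of dim_col] assms(1) by auto
  then have "det W * det V = 1" using det_mult[of W n V] assms(1) V(1) by simp
  then show ?thesis by auto
qed

text \<open>The pencil factors as W diag(z I - J, -I) T, and only the first block can make the
  determinant vanish. The field is arbitrary so that the statement applies to complexified
  matrices.\<close>

lemma det_pencil_eq_0_iff:
  fixes W T J :: "'a :: field mat"
  assumes W: "W \<in> carrier_mat n n" "det W \<noteq> 0" and T: "T \<in> carrier_mat n n" "det T \<noteq> 0"
    and J: "J \<in> carrier_mat q q" and q: "q \<le> n"
  shows "det (z \<cdot>\<^sub>m (W * four_block_mat (1\<^sub>m q) (0\<^sub>m q (n - q)) (0\<^sub>m (n - q) q) (0\<^sub>m (n - q) (n - q)) * T)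
      - W * four_block_mat J (0\<^sub>m q (n - q)) (0\<^sub>m (n - q) q) (1\<^sub>m (n - q)) * T) = 0 \<longleftrightarrow> eigenvalue J z"
proof -
  let ?m = "n - q"
  let ?F = "four_block_mat (1\<^sub>m q) (0\<^sub>m q ?m) (0\<^sub>m ?m q) (0\<^sub>m ?m ?m) :: 'a mat"
  let ?G = "four_block_mat J (0\<^sub>m q ?m) (0\<^sub>m ?m q) (1\<^sub>m ?m)"
  \<comment> \<open>\<open>char_matrix J z\<close> stands for J - z I, hence the sign.\<close>
  let ?H = "four_block_mat (- char_matrix J z) (0\<^sub>m q ?m) (0\<^sub>m ?m q) (- (1\<^sub>m ?m))"
  have F: "?F \<in> carrier_mat n n" and G: "?G \<in> carrier_mat n n" and H: "?H \<in> carrier_mat n n"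
    using J q four_block_carrier_mat[of "1\<^sub>m q :: 'a mat" q q "0\<^sub>m ?m ?m" ?m ?m]
      four_block_carrier_mat[of J q q "1\<^sub>m ?m" ?m ?m]
      four_block_carrier_mat[of "- char_matrix J z" q q "- (1\<^sub>m ?m)" ?m ?m] by auto
  have HFG: "?H = z \<cdot>\<^sub>m ?F - ?G"
    using J by (intro eq_matI) (auto simp: char_matrix_def)
  have "z \<cdot>\<^sub>m (W * ?F * T) - W * ?G * T = (z \<cdot>\<^sub>m (W * ?F) - W * ?G) * T"
    using W(1) T(1) F G
    by (simp add: minus_mult_distrib_mat[of _ n n _ _ n] mult_smult_assoc_mat[of _ n n _ n] mult_carrier_mat[of _ n n _ n])
  also have "z \<cdot>\<^sub>m (W * ?F) - W * ?G = W * ?H"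
    unfolding HFG using W(1) F G
    by (simp add: mult_minus_distrib_mat[of _ n n _ n] mult_smult_distrib[of _ n n _ n])
  finally have "det (z \<cdot>\<^sub>m (W * ?F * T) - W * ?G * T) = det W * det ?H * det T"
    using det_mult[of "W * ?H" n T] det_mult[of W n ?H] W T H by simp
  moreover have "det ?H = det (- char_matrix J z) * det (- (1\<^sub>m ?m) :: 'a mat)"
    using J by (intro det_four_block_mat_lower_left_zero[of _ q _ ?m]) auto
  moreover have "det (- (1\<^sub>m ?m) :: 'a mat) \<noteq> 0"
    using det_0_negate[of "1\<^sub>m ?m :: 'a mat" ?m] by simp
  moreover have "det (- char_matrix J z) = 0 \<longleftrightarrow> eigenvalue J z"
    using det_0_negate[of "char_matrix J z" q] J eigenvalue_det[OF J] by simp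
  ultimately show ?thesis using W(2) T(2) by simp
qed

lemma finite_eigenvalues_pencil:
  assumes W: "W \<in> carrier_mat n n" "invertible_mat W" and T: "T \<in> carrier_mat n n" "invertible_mat T"
    and J: "J \<in> carrier_mat q q" and q: "q \<le> n"
    and E: "E = W * four_block_mat (1\<^sub>m q) (0\<^sub>m q (n - q)) (0\<^sub>m (n - q) q) (0\<^sub>m (n - q) (n - q)) * T"
    and A: "A = W * four_block_mat J (0\<^sub>m q (n - q)) (0\<^sub>m (n - q) q) (1\<^sub>m (n - q)) * T"
  shows "finite_eigenvalues E A = {z. eigenvalue (map_mat complex_of_real J) z}"
proof -
  let ?c = "map_mat complex_of_real"
  let ?m = "n - q"
  let ?F = "four_block_mat (1\<^sub>m q) (0\<^sub>m q ?m) (0\<^sub>m ?m q) (0\<^sub>m ?m ?m) :: real mat"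
  let ?G = "four_block_mat J (0\<^sub>m q ?m) (0\<^sub>m ?m q) (1\<^sub>m ?m)"
  have F: "?F \<in> carrier_mat n n" and G: "?G \<in> carrier_mat n n"
    using J q four_block_carrier_mat[of "1\<^sub>m q :: real mat" q q "0\<^sub>m ?m ?m" ?m ?m]
      four_block_carrier_mat[of J q q "1\<^sub>m ?m" ?m ?m] by auto
  have cF: "?c ?F = four_block_mat (1\<^sub>m q) (0\<^sub>m q ?m) (0\<^sub>m ?m q) (0\<^sub>m ?m ?m)"
    by (rule eq_matI) auto
  have cG: "?c ?G = four_block_mat (?c J) (0\<^sub>m q ?m) (0\<^sub>m ?m q) (1\<^sub>m ?m)"
    using J by (intro eq_matI) auto
  have cE: "?c E = ?c W * four_block_mat (1\<^sub>m q) (0\<^sub>m q ?m) (0\<^sub>m ?m q) (0\<^sub>m ?m ?m) * ?c T"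
    unfolding E of_real_hom.mat_hom_mult[OF mult_carrier_mat[OF W(1) F] T(1)]
      of_real_hom.mat_hom_mult[OF W(1) F] cF ..
  have cA: "?c A = ?c W * four_block_mat (?c J) (0\<^sub>m q ?m) (0\<^sub>m ?m q) (1\<^sub>m ?m) * ?c T"
    unfolding A of_real_hom.mat_hom_mult[OF mult_carrier_mat[OF W(1) G] T(1)]
      of_real_hom.mat_hom_mult[OF W(1) G] cG ..
  have "det (?c W) \<noteq> 0" "det (?c T) \<noteq> 0"
    using invertible_mat_det_nonzero[OF W] invertible_mat_det_nonzero[OF T] by auto
  then show ?thesis
    unfolding finite_eigenvalues_def cE cA using W(1) T(1) J q
    by (subst det_pencil_eq_0_iff) auto
qed

text \<open>The point 1 lies outside the open unit disk, so it is no finite eigenvalue and the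
  determinant of E - A is nonzero.\<close>

lemma asymp_stable_imp_regular_pair:
  assumes EA: "E \<in> carrier_mat n n" "A \<in> carrier_mat n n" and stable: "asymp_stable E A"
  shows "regular_pair E A"
proof -
  have "1 \<notin> finite_eigenvalues E A" using stable unfolding asymp_stable_def by auto
  then have "det (1 \<cdot>\<^sub>m map_mat complex_of_real E - map_mat complex_of_real A) \<noteq> 0"
    unfolding finite_eigenvalues_def by blast
  moreover have "1 \<cdot>\<^sub>m map_mat complex_of_real E - map_mat complex_of_real A =
    map_mat complex_of_real (1 \<cdot>\<^sub>m E - A)"
    using EA by (intro eq_matI) auto
  ultimately have "det (1 \<cdot>\<^sub>m E - A) \<noteq> 0" by auto
  then show ?thesis unfolding regular_pair_def by blast
qed

text \<open>The invertible right factor does not change the column space. The columns of the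
  remaining product are the first \<open>q\<close> columns of \<open>W\<close>, which are
  independent, and zeros.\<close>

lemma rank_mult_four_block_one:
  fixes W T :: "real mat"
  assumes W: "W \<in> carrier_mat n n" "invertible_mat W" and T: "T \<in> carrier_mat n n" "invertible_mat T"
    and q: "q \<le> n"
  shows "vec_space.rank n
    (W * four_block_mat (1\<^sub>m q) (0\<^sub>m q (n - q)) (0\<^sub>m (n - q) q) (0\<^sub>m (n - q) (n - q)) * T) = q"
proof -
  let ?F = "four_block_mat (1\<^sub>m q) (0\<^sub>m q (n - q)) (0\<^sub>m (n - q) q) (0\<^sub>m (n - q) (n - q)) :: real mat"
  interpret vec_space "TYPE(real)" n .
  have F: "?F \<in> carrier_mat n n"
    using q four_block_carrier_mat[of "1\<^sub>m q :: real mat" q q "0\<^sub>m (n - q) (n - q)" "n - q" "n - q"] by auto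
  define X where "X = W * ?F"
  have X: "X \<in> carrier_mat n n" unfolding X_def using W(1) F by simp
  have XT: "X * T \<in> carrier_mat n n" using X T(1) by simp
  obtain T' where T': "T' \<in> carrier_mat n n" "T * T' = 1\<^sub>m n"
    using det_non_zero_imp_unit[OF T(1) invertible_mat_det_nonzero[OF T], of undefined]
    unfolding Units_def by (auto simp: ring_mat_simps)
  have "col_space (X * T) = col_space X"
  proof (intro equalityI subsetI)
    fix y assume "y \<in> col_space (X * T)"
    then obtain x where "x \<in> carrier_vec n" "y = X *\<^sub>v (T *\<^sub>v x)"
      unfolding col_space_eq[OF XT] using X T(1) by (auto simp: assoc_mult_mat_vec[of _ n n _ n])
    then show "y \<in> col_space X" unfolding col_space_eq[OF X] using X T(1) by auto
  next
    fix y assume "y \<in> col_space X"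
    then obtain x where x: "x \<in> carrier_vec n" "y = X *\<^sub>v x"
      unfolding col_space_eq[OF X] using X by auto
    have "x = (T * T') *\<^sub>v x" unfolding T' using x by simp
    also have "\<dots> = T *\<^sub>v (T' *\<^sub>v x)" using T(1) T'(1) x by (simp add: assoc_mult_mat_vec[of _ n n _ n])
    finally have "y = (X * T) *\<^sub>v (T' *\<^sub>v x)"
      using x X T(1) T'(1) by (simp add: assoc_mult_mat_vec[of _ n n _ n])
    then show "y \<in> col_space (X * T)"
      unfolding col_space_eq[OF XT] using X T(1) T'(1) x by auto
  qed
  then have "rank (X * T) = rank X" unfolding rank_def col_space_def by simp
  also have "rank X = q"
  proof -
    have rW: "rank W = n" using det_rank_iff[OF W(1)] invertible_mat_det_nonzero[OF W] by simp
    \<comment> \<open>Independence is a property of the set of columns, so distinctness is required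
      to count them.\<close>
    then have dist: "distinct (cols W)" using non_distinct_low_rank[OF W(1)] by auto
    have li: "lin_indpt (set (cols W))" by (rule full_rank_lin_indpt[OF W(1) rW dist])
    have colX: "col X j = (if j < q then col W j else 0\<^sub>v n)" if j: "j < n" for j
    proof -
      have "col ?F j = (if j < q then unit_vec n j else 0\<^sub>v n)"
        using j q by (intro eq_vecI) auto
      then have "col X j = W *\<^sub>v (if j < q then unit_vec n j else 0\<^sub>v n)"
        unfolding X_def using col_mult2[OF W(1) F j] by simp
      then show ?thesis using mult_mat_unit_vec[OF W(1) j] mult_mat_zero_vec[OF W(1)] by simp
    qed
    define S where "S = col W ` {..<q}"
    have colsW: "set (cols W) = col W ` {..<n}"
      using W(1) unfolding cols_def by auto
    have "inj_on (col W) {..<n}"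
    proof (rule inj_onI)
      fix i j assume "i \<in> {..<n}" "j \<in> {..<n}" "col W i = col W j"
      then show "i = j" using nth_eq_iff_index_eq[OF dist, of i j] W(1) by simp
    qed
    then have cS: "card S = q"
      unfolding S_def using q by (subst card_image) (auto intro: inj_on_subset)
    have colsX: "set (cols X) = col X ` {..<n}"
      using X unfolding cols_def by auto
    have S1: "S \<subseteq> set (cols X)"
      unfolding S_def colsX using colX q by force
    have S2: "set (cols X) \<subseteq> insert (0\<^sub>v n) S"
      unfolding S_def colsX using colX by auto
    have liS: "lin_indpt S"
      using li by (rule subset_li_is_li) (use q in \<open>auto simp: S_def colsW\<close>)
    \<comment> \<open>A larger set of columns would contain the zero vector and be
      dependent.\<close>
    have "maximal S (\<lambda>Y. Y \<subseteq> set (cols X) \<and> lin_indpt Y)"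
      unfolding maximal_def
    proof (intro conjI allI impI)
      fix Y assume Y: "S \<subseteq> Y \<and> Y \<subseteq> set (cols X) \<and> lin_indpt Y"
      then have Yc: "Y \<subseteq> carrier_vec n" using cols_dim[of X] X by auto
      have "carrier class_ring \<noteq> {0 :: real}"
        using UNIV_I[of "1 :: real"] by (metis class_ring_simps(1) singletonD zero_neq_one)
      then have "0\<^sub>v n \<notin> Y" using zero_nin_lin_indpt[of Y] Y Yc by simp
      then show "Y = S" using Y S2 by auto
    qed (use S1 liS in auto)
    from rank_card_indpt[OF X this] show ?thesis using cS by simp
  qed
  finally show ?thesis unfolding X_def .
qed

section \<open>Index at most one and the equivalence\<close>

text \<open>Exponent 1 always works. Equality fails for \<open>m = 0\<close>, where exponent 0
  already gives the zero matrix.\<close>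

lemma nilp_degree_zero_le: "nilp_degree (0\<^sub>m m m) \<le> 1"
  unfolding nilp_degree_def by (rule Least_le) simp

lemma index_le_1_imp_nilpotent_zero:
  assumes wf: "weierstrass_form n E A q W T J N" and ind: "wcf_index n q N \<le> 1"
  shows "N = 0\<^sub>m (n - q) (n - q)"
proof (cases "q < n")
  case True
  have N: "N \<in> carrier_mat (n - q) (n - q)" and ex: "\<exists>k. N ^\<^sub>m k = 0\<^sub>m (n - q) (n - q)"
    using wf unfolding weierstrass_form_def by auto
  define k where "k = nilp_degree N"
  have "N ^\<^sub>m k = 0\<^sub>m (n - q) (n - q)"
    using LeastI_ex[OF ex] N unfolding k_def nilp_degree_def by simp
  moreover have "k = 0 \<or> k = 1" using ind True unfolding wcf_index_def k_def by auto
  ultimately consider "1\<^sub>m (n - q) = (0\<^sub>m (n - q) (n - q) :: real mat)" | "N = 0\<^sub>m (n - q) (n - q)"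
    using N by auto
  then show ?thesis
  proof cases
    case 1
    \<comment> \<open>Degree 0 would make the identity zero, which its corner entry refutes in
      positive dimension.\<close>
    have "(1\<^sub>m (n - q) :: real mat) $$ (0, 0) = 0" unfolding 1 using True by simp
    then show ?thesis using True by simp
  qed
next
  case False
  have "N \<in> carrier_mat (n - q) (n - q)" using wf unfolding weierstrass_form_def by auto
  with False show ?thesis by (intro eq_matI) auto
qed

theorem theorem5:
  fixes E A :: "real mat" and n r :: nat
  assumes "E \<in> carrier_mat n n" and "A \<in> carrier_mat n n"
    and "vec_space.rank n E = r"
  shows "(regular_pair E A \<and> index_at_most n E A 1 \<and> asymp_stable E A) \<longleftrightarrow>
    (\<exists>T W S Sinv U B.
        T \<in> carrier_mat n n \<and> W \<in> carrier_mat n n \<and> invertible_mat T \<and> invertible_mat W \<and>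
        S \<in> carrier_mat r r \<and> Sinv \<in> carrier_mat r r \<and> U \<in> carrier_mat r r \<and> B \<in> carrier_mat r r \<and>
        S * Sinv = 1\<^sub>m r \<and> Sinv * S = 1\<^sub>m r \<and>
        transpose_mat U * U = 1\<^sub>m r \<and>
        transpose_mat B = B \<and> psd_mat B \<and> spec_norm B < 1 \<and>
        E = W * four_block_mat (1\<^sub>m r) (0\<^sub>m r (n - r)) (0\<^sub>m (n - r) r) (0\<^sub>m (n - r) (n - r)) * T \<and>
        A = W * four_block_mat (Sinv * U * B * S) (0\<^sub>m r (n - r)) (0\<^sub>m (n - r) r) (1\<^sub>m (n - r)) * T)"
    (is "?L \<longleftrightarrow> ?R")
proof
  assume ?L
  then have stable: "asymp_stable E A" and "index_at_most n E A 1" by auto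
  then obtain q W T J N where wf: "weierstrass_form n E A q W T J N" and ind: "wcf_index n q N \<le> 1"
    unfolding index_at_most_def by auto
  note N = index_le_1_imp_nilpotent_zero[OF wf ind]
  from wf have q: "q \<le> n" and W: "W \<in> carrier_mat n n" "invertible_mat W"
    and T: "T \<in> carrier_mat n n" "invertible_mat T" and J: "J \<in> carrier_mat q q"
    and E: "E = W * four_block_mat (1\<^sub>m q) (0\<^sub>m q (n - q)) (0\<^sub>m (n - q) q) (0\<^sub>m (n - q) (n - q)) * T"
    and A: "A = W * four_block_mat J (0\<^sub>m q (n - q)) (0\<^sub>m (n - q) q) (1\<^sub>m (n - q)) * T"
    unfolding weierstrass_form_def N by auto
  \<comment> \<open>With \<open>N\<close> equal to zero, the rank of \<open>E\<close> determines the
    block size.\<close>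
  have qr: "q = r" using rank_mult_four_block_one[OF W T q] assms(3) E by simp
  have "cmod z < 1" if "eigenvalue (map_mat complex_of_real J) z" for z
    using stable that unfolding asymp_stable_def finite_eigenvalues_pencil[OF W T J q E A] by auto
  from stable_decomposition[OF J this] obtain S S' U B
    where SUB: "S \<in> carrier_mat q q" "S' \<in> carrier_mat q q" "S * S' = 1\<^sub>m q" "S' * S = 1\<^sub>m q"
      "orth_mat q U" "B \<in> carrier_mat q q" "B\<^sup>T = B" "psd_mat B" "spec_norm B < 1"
      and Jeq: "J = S' * U * B * S" by auto
  show ?R
    by (rule exI[of _ T], rule exI[of _ W], rule exI[of _ S], rule exI[of _ S'], rule exI[of _ U],
        rule exI[of _ B], intro conjI)
      (fact T W SUB[unfolded qr] orth_matD[OF SUB(5), unfolded qr] E[unfolded qr] A[unfolded qr Jeq])+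
next
  assume ?R
  then obtain T W S S' U B where T: "T \<in> carrier_mat n n" "invertible_mat T"
    and W: "W \<in> carrier_mat n n" "invertible_mat W"
    and S: "S \<in> carrier_mat r r" "S' \<in> carrier_mat r r" "S * S' = 1\<^sub>m r" "S' * S = 1\<^sub>m r"
    and U: "orth_mat r U" and B: "B \<in> carrier_mat r r" "spec_norm B < 1"
    and E: "E = W * four_block_mat (1\<^sub>m r) (0\<^sub>m r (n - r)) (0\<^sub>m (n - r) r) (0\<^sub>m (n - r) (n - r)) * T"
    and A: "A = W * four_block_mat (S' * U * B * S) (0\<^sub>m r (n - r)) (0\<^sub>m (n - r) r) (1\<^sub>m (n - r)) * T"
    unfolding orth_mat_def by auto
  \<comment> \<open>Keeps the truncated subtraction \<open>n - r\<close> meaningful, so that the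
    blocks fill size \<open>n\<close>.\<close>
  have r: "r \<le> n" using vec_space.rank_le_nc[OF assms(1)] assms(3) by simp
  have J: "S' * U * B * S \<in> carrier_mat r r"
    using S(1,2) orth_matD(1)[OF U] B(1) by (simp add: mult_carrier_mat[of _ r r _ r])
  have stable: "asymp_stable E A"
    unfolding asymp_stable_def finite_eigenvalues_pencil[OF W T J r E A]
    using decomposition_stable[OF S U B] by auto
  have pow: "(0\<^sub>m (n - r) (n - r) :: real mat) ^\<^sub>m 1 = 0\<^sub>m (n - r) (n - r)" by simp
  \<comment> \<open>The given factorization is already a Weierstrass form with zero nilpotent block;
    exponent 1 witnesses nilpotency.\<close>
  have "weierstrass_form n E A r W T (S' * U * B * S) (0\<^sub>m (n - r) (n - r))"
    unfolding weierstrass_form_def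
    by (intro conjI exI[of _ 1]) (fact r W T J zero_carrier_mat pow E A)+
  moreover have "wcf_index n r (0\<^sub>m (n - r) (n - r)) \<le> 1"
    unfolding wcf_index_def using nilp_degree_zero_le by simp
  ultimately have "index_at_most n E A 1" unfolding index_at_most_def by (intro exI conjI)
  then show ?L using stable asymp_stable_imp_regular_pair[OF assms(1,2)] by blast
qed

end
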